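(* Let ${\bf r}=\sum_{k\ge2}{\bf p}_k$ be the measure on binary partitions of $\mathbb{N}$ defined in the context. For ${\bf r}$-almost all binary partitions $(B_1,B_2)\in\mathcal{P}$, the blocks $B_1$ and $B_2$ have asymptotic frequencies $|B_1|,|B_2|$, and more precisely, $$\int_{\mathcal{P}}f(|B_1|,|B_2|)\,\mathrm{d}{\bf r}=\int_0^1f(1-x,x)\,x^{-2}\,\mathrm{d}x,$$ where $f:[0,1]^2\to\mathbb{R}_+$ denotes a generic measurable function. In particular, $$\int_{\mathcal{P}}(1-|B_1|)\,\mathrm{d}{\bf r}=\infty.$$
   Context: $\mathbb{N}=\{1,2,\ldots\}$. $\mathcal{P}$ is the space of partitions of $\mathbb{N}$, where the blocks of a partition are listed in increasing order of their smallest elements; a binary partition $(B_1,B_2)$ is one with exactly two non-empty blocks (so $1\in B_1$). The asymptotic frequency of $B\subseteq\mathbb{N}$ is $|B|=\lim_{n\to\infty}n^{-1}\#\{i\le n:i\in B\}$, when the limit exists. For $k\ge2$, consider a Pólya urn containing initially $k-1$ black balls labeled $1,\ldots,k-1$ and one red ball labeled $k$; for each $n\ge k$, the ball labeled $n+1$ is added with the color of a ball picked uniformly at random among the $n$ balls present. ${\bf p}_k$ is the law of the resulting random binary partition of $\mathbb{N}$ into the block of labels of black balls and the block of labels of red balls, and ${\bf r}=\sum_{k=2}^\infty{\bf p}_k$. *)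

theory Defs
  imports "HOL-Probability.Probability"
begin

text \<open>The set \<open>{1..}\<close> of type \<^typ>\<open>nat set\<close> plays the role of $\mathbb{N} = \{1, 2, \ldots\}$.\<close>

definition restrict_partition :: "nat set set \<Rightarrow> nat \<Rightarrow> nat set set" where
  "restrict_partition \<pi> n = (\<lambda>B. B \<inter> {1..n}) ` \<pi> - {{}}"

text \<open>
  The \<open>\<sigma>\<close>-algebra on partitions is generated by the restriction maps to \<open>{1..n}\<close>; it is the Borel
  \<open>\<sigma>\<close>-algebra of the usual compact topology on the space of partitions.
\<close>

definition partition_space :: "nat set set measure" where
  "partition_space = sigma {\<pi>. partition_on {1..} \<pi>}
     {{\<pi>. partition_on {1..} \<pi> \<and> restrict_partition \<pi> n = \<rho>} | n \<rho>. True}"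

text \<open>
  The \<open>i\<close>-th block (\<open>i \<ge> 1\<close>) in increasing order of smallest elements is the one with exactly
  \<open>i - 1\<close> blocks having a smaller least element. It is empty if there are fewer than \<open>i\<close> blocks.
\<close>

definition nth_block :: "nat set set \<Rightarrow> nat \<Rightarrow> nat set" where
  "nth_block \<pi> i = \<Union>{B \<in> \<pi>. Suc (card {C \<in> \<pi>. Inf C < Inf B}) = i}"

text \<open>The value at \<open>n = 0\<close> is \<open>0 / 0 = 0\<close>, which has no influence on the limit.\<close>

definition prefix_frequency :: "nat set \<Rightarrow> nat \<Rightarrow> real" where
  "prefix_frequency B n = real (card {i \<in> {1..n}. i \<in> B}) / real n"

definition has_asymptotic_frequency :: "nat set \<Rightarrow> bool" where
  "has_asymptotic_frequency B \<longleftrightarrow> convergent (prefix_frequency B)"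

definition asymptotic_frequency :: "nat set \<Rightarrow> real" where
  "asymptotic_frequency B = lim (prefix_frequency B)"

text \<open>
  The randomness of the urn: for each \<open>n \<ge> k\<close>, independently, \<open>u n\<close> is the label of the ball picked
  uniformly from the \<open>n\<close> balls present; ball \<open>n + 1\<close> then receives the colour of ball \<open>u n\<close>.
\<close>

definition urn_picks :: "nat \<Rightarrow> (nat \<Rightarrow> nat) measure" where
  "urn_picks k = PiM {k..} (\<lambda>n. uniform_count_measure {1..n})"

inductive_set red_labels :: "nat \<Rightarrow> (nat \<Rightarrow> nat) \<Rightarrow> nat set" for k u where
  initial: "k \<in> red_labels k u"
| added: "k \<le> n \<Longrightarrow> u n \<in> red_labels k u \<Longrightarrow> Suc n \<in> red_labels k u"

definition urn_partition :: "nat \<Rightarrow> (nat \<Rightarrow> nat) \<Rightarrow> nat set set" where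
  "urn_partition k u = {{1..} - red_labels k u, red_labels k u}"

definition urn_law :: "nat \<Rightarrow> nat set set measure" where
  "urn_law k = distr (urn_picks k) partition_space (urn_partition k)"

definition urn_sum_measure :: "nat set set measure" where
  "urn_sum_measure = measure_of (space partition_space) (sets partition_space)
     (\<lambda>A. \<Sum>k. emeasure (urn_law (k + 2)) A)"


subsection \<open>The measures are well defined\<close>

lemma space_partition_space: "space partition_space = {\<pi>. partition_on {1..} \<pi>}"
  unfolding partition_space_def by (subst space_measure_of) auto

lemma red_labels_iff:
  "m \<in> red_labels k u \<longleftrightarrow> m = k \<or> (\<exists>n. m = Suc n \<and> k \<le> n \<and> u n \<in> red_labels k u)"
  by (subst red_labels.simps) blast

lemma red_labels_ge: "m \<in> red_labels k u \<Longrightarrow> k \<le> m"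
  by (induction rule: red_labels.induct) auto

lemma partition_on_urn_partition:
  assumes "k \<ge> 2"
  shows "partition_on {1..} (urn_partition k u)"
proof -
  have "1 \<notin> red_labels k u" using red_labels_ge[of 1 k u] assms by auto
  moreover have "red_labels k u \<subseteq> {1..}" using red_labels_ge assms by fastforce
  moreover have "k \<in> red_labels k u" by (rule red_labels.initial)
  ultimately show ?thesis
    unfolding partition_on_def urn_partition_def disjoint_def
    by (auto simp: subset_iff)
qed

lemma card_urn_partition:
  assumes "k \<ge> 2"
  shows "card (urn_partition k u) = 2"
proof -
  have "k \<in> red_labels k u" by (rule red_labels.initial)
  then have "{1..} - red_labels k u \<noteq> red_labels k u" by blast
  then show ?thesis by (simp add: urn_partition_def)
qed

lemma prob_space_urn_picks:
  assumes "k \<ge> 1"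
  shows "prob_space (urn_picks k)"
  unfolding urn_picks_def
  by (rule prob_space_PiM, rule prob_space_uniform_count_measure) (use assms in auto)

lemma sets_red_labels:
  assumes "k \<ge> 1"
  shows "{u \<in> space (urn_picks k). m \<in> red_labels k u} \<in> sets (urn_picks k)"
proof (induction m rule: less_induct)
  case (less m)
  show ?case
  proof (cases "m > k")
    case False
    then have "m \<in> red_labels k u \<longleftrightarrow> m = k" for u
      using red_labels_ge[of m k u] red_labels.initial[of k u] by auto
    then show ?thesis by simp
  next
    case True
    then obtain n where n: "m = Suc n" "k \<le> n" by (cases m) auto
    have "u n \<in> {1..n}" if "u \<in> space (urn_picks k)" for u
      using that n by (auto simp: urn_picks_def space_PiM PiE_iff space_uniform_count_measure)
    moreover have "m \<in> red_labels k u \<longleftrightarrow> u n \<in> red_labels k u" for u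
      using n by (subst red_labels_iff) auto
    ultimately have eq: "{u \<in> space (urn_picks k). m \<in> red_labels k u} =
      (\<Union>j\<in>{1..n}. {u \<in> space (urn_picks k). u n = j} \<inter> {u \<in> space (urn_picks k). j \<in> red_labels k u})"
      by blast
    have comp: "(\<lambda>u. u n) \<in> measurable (urn_picks k) (uniform_count_measure {1..n})"
      unfolding urn_picks_def using n by (intro measurable_component_singleton) auto
    have "{u \<in> space (urn_picks k). u n = j} \<in> sets (urn_picks k)" if "j \<in> {1..n}" for j
    proof -
      have "(\<lambda>u. u n) -` {j} \<inter> space (urn_picks k) \<in> sets (urn_picks k)"
        by (rule measurable_sets[OF comp]) (use that in \<open>auto simp: sets_uniform_count_measure\<close>)
      moreover have "(\<lambda>u. u n) -` {j} \<inter> space (urn_picks k) = {u \<in> space (urn_picks k). u n = j}"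
        by auto
      ultimately show ?thesis by simp
    qed
    with less n show ?thesis unfolding eq by (intro sets.finite_UN sets.Int) auto
  qed
qed

lemma Int_mem_iff:
  assumes "\<D> \<subseteq> Pow I"
  shows "R \<inter> I \<in> \<D> \<longleftrightarrow> (\<exists>D\<in>\<D>. \<forall>m\<in>I. m \<in> R \<longleftrightarrow> m \<in> D)"
proof
  assume "R \<inter> I \<in> \<D>"
  then show "\<exists>D\<in>\<D>. \<forall>m\<in>I. m \<in> R \<longleftrightarrow> m \<in> D" by (intro bexI[of _ "R \<inter> I"]) auto
next
  assume "\<exists>D\<in>\<D>. \<forall>m\<in>I. m \<in> R \<longleftrightarrow> m \<in> D"
  then obtain D where D: "D \<in> \<D>" "\<forall>m\<in>I. m \<in> R \<longleftrightarrow> m \<in> D" by blast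
  then have "R \<inter> I = D" using assms by blast
  with D show "R \<inter> I \<in> \<D>" by simp
qed

lemma Collect_bex_UN: "{u \<in> S. \<exists>D\<in>\<D>. P u D} = (\<Union>D\<in>\<D>. {u \<in> S. P u D})"
  by auto

lemma restrict_urn_partition:
  "restrict_partition (urn_partition k u) n =
     {{1..n} - (red_labels k u \<inter> {1..n}), red_labels k u \<inter> {1..n}} - {{}}"
proof -
  have "({1..} - red_labels k u) \<inter> {1..n} = {1..n} - (red_labels k u \<inter> {1..n})" by auto
  then show ?thesis by (simp add: restrict_partition_def urn_partition_def)
qed

lemma measurable_urn_partition:
  assumes "k \<ge> 2"
  shows "urn_partition k \<in> measurable (urn_picks k) partition_space"
  unfolding partition_space_def
proof (rule measurable_sigma_sets[OF sets_measure_of])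
  show "urn_partition k \<in> space (urn_picks k) \<rightarrow> {\<pi>. partition_on {1..} \<pi>}"
    using partition_on_urn_partition[OF assms] by auto
next
  fix A assume "A \<in> {{\<pi>. partition_on {1..} \<pi> \<and> restrict_partition \<pi> n = \<rho>} | n \<rho>. True}"
  then obtain n \<rho> where A: "A = {\<pi>. partition_on {1..} \<pi> \<and> restrict_partition \<pi> n = \<rho>}" by auto
  let ?D = "{D \<in> Pow {1..n}. {{1..n} - D, D} - {{}} = \<rho>}"
  have "urn_partition k -` A \<inter> space (urn_picks k)
      = {u \<in> space (urn_picks k). red_labels k u \<inter> {1..n} \<in> ?D}"
    using partition_on_urn_partition[OF assms] by (auto simp: A restrict_urn_partition)
  also have "\<dots> = (\<Union>D\<in>?D. {u \<in> space (urn_picks k). \<forall>m\<in>{1..n}. m \<in> red_labels k u \<longleftrightarrow> m \<in> D})"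
  proof -
    have "red_labels k u \<inter> {1..n} \<in> ?D \<longleftrightarrow>
        (\<exists>D\<in>?D. \<forall>m\<in>{1..n}. m \<in> red_labels k u \<longleftrightarrow> m \<in> D)" for u
      by (rule Int_mem_iff) (rule Collect_restrict)
    then have "{u \<in> space (urn_picks k). red_labels k u \<inter> {1..n} \<in> ?D} =
        {u \<in> space (urn_picks k). \<exists>D\<in>?D. \<forall>m\<in>{1..n}. m \<in> red_labels k u \<longleftrightarrow> m \<in> D}"
      by presburger
    also have "\<dots> = (\<Union>D\<in>?D. {u \<in> space (urn_picks k). \<forall>m\<in>{1..n}. m \<in> red_labels k u \<longleftrightarrow> m \<in> D})"
      by (rule Collect_bex_UN)
    finally show ?thesis .
  qed
  also have "\<dots> \<in> sets (urn_picks k)"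
  proof (intro sets.finite_UN)
    fix D
    have "{u \<in> space (urn_picks k). m \<in> red_labels k u \<longleftrightarrow> m \<in> D} \<in> sets (urn_picks k)" for m
    proof -
      have red: "{u \<in> space (urn_picks k). m \<in> red_labels k u} \<in> sets (urn_picks k)"
        using assms by (intro sets_red_labels) simp
      show ?thesis
      proof (cases "m \<in> D")
        case True
        with red show ?thesis by simp
      next
        case False
        with sets.sets_Collect_neg[OF red] show ?thesis by simp
      qed
    qed
    then show "{u \<in> space (urn_picks k). \<forall>m\<in>{1..n}. m \<in> red_labels k u \<longleftrightarrow> m \<in> D} \<in> sets (urn_picks k)"
      by (intro sets.sets_Collect_finite_All finite_atLeastAtMost)
  qed simp
  finally show "urn_partition k -` A \<inter> space (urn_picks k) \<in> sets (urn_picks k)" .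
qed auto

lemma prob_space_urn_law: "k \<ge> 2 \<Longrightarrow> prob_space (urn_law k)"
  unfolding urn_law_def
  by (intro prob_space.prob_space_distr prob_space_urn_picks measurable_urn_partition) auto

lemma sets_urn_law: "sets (urn_law k) = sets partition_space"
  by (simp add: urn_law_def)

lemma sets_urn_sum_measure: "sets urn_sum_measure = sets partition_space"
  unfolding urn_sum_measure_def by (simp add: sets.space_closed sets.sigma_sets_eq)

lemma space_urn_sum_measure: "space urn_sum_measure = space partition_space"
  unfolding urn_sum_measure_def by (simp add: sets.space_closed space_measure_of)

lemma emeasure_urn_sum_measure:
  assumes "A \<in> sets partition_space"
  shows "emeasure urn_sum_measure A = (\<Sum>k. emeasure (urn_law (k + 2)) A)"
proof (rule emeasure_measure_of[OF urn_sum_measure_def sets.space_closed])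
  show "A \<in> sets urn_sum_measure" using assms by (simp add: sets_urn_sum_measure)
  show "positive (sets urn_sum_measure) (\<lambda>A. \<Sum>k. emeasure (urn_law (k + 2)) A)"
    by (simp add: positive_def)
  show "countably_additive (sets urn_sum_measure) (\<lambda>A. \<Sum>k. emeasure (urn_law (k + 2)) A)"
  proof (rule countably_additiveI)
    fix F :: "nat \<Rightarrow> nat set set set"
    assume F: "range F \<subseteq> sets urn_sum_measure" "disjoint_family F"
    have "(\<Sum>i. \<Sum>k. emeasure (urn_law (k + 2)) (F i)) = (\<Sum>k. \<Sum>i. emeasure (urn_law (k + 2)) (F i))"
      by (subst (1 2) nn_integral_count_space_nat[symmetric])
        (simp add: nn_integral_suminf)
    also have "\<dots> = (\<Sum>k. emeasure (urn_law (k + 2)) (\<Union>i. F i))"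
      using F by (intro suminf_cong suminf_emeasure) (auto simp: sets_urn_law sets_urn_sum_measure)
    finally show "(\<Sum>i. \<Sum>k. emeasure (urn_law (k + 2)) (F i)) = (\<Sum>k. emeasure (urn_law (k + 2)) (\<Union>i. F i))" .
  qed
qed

end

theory Submission
  imports Defs
begin

text \<open>
  Fix \<open>k \<ge> 2\<close> and let \<open>R n\<close> be the number of red balls among the first \<open>n\<close> of the urn that starts with
  \<open>k - 1\<close> black balls and one red ball. The rising factorial \<open>R n (R n + 1) \<dots> (R n + m - 1)\<close> is multiplied
  in conditional mean by \<open>(n + m) / n\<close> when ball \<open>n + 1\<close> is added, so its expectation is explicit
  (\<open>integral_pochhammer_red\<close>). The proof rests on this computation and on the martingale property of
  the proportion \<open>R n / n\<close>.

  \<^item> The increment of the proportion from time \<open>m\<close> to time \<open>n\<close> has second moment at most \<open>1 / m - 1 / n\<close>.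
  Along the cubes the absolute increments therefore have summable means, and between consecutive cubes the count is monotone, so the
  proportion converges almost surely (\<open>AE_convergent_red_fraction\<close>).

  \<^item> By dominated convergence the \<open>m\<close>-th moment of the limit is \<open>m! / (k (k + 1) \<dots> (k + m - 1))\<close>. These are
  the moments of the density \<open>(k - 1) (1 - x)\<^bsup>k - 2\<^esup>\<close> on the unit interval, and a law on the unit
  interval is determined by its moments (\<open>distr_limit_fraction\<close>).

  \<^item> Summing over \<open>k\<close> gives the derivative of the geometric series, \<open>\<Sum>k\<ge>2. (k - 1) (1 - x)\<^bsup>k - 2\<^esup> = 1 / x\<^sup>2\<close>,
  which is the density of the frequency of the second block under the sum of the urn laws
  (\<open>distr_urn_sum_measure\<close>).

  Since the frequency of the first block is one minus that of the second, the integral formula is a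
  change of variables. Taking \<open>f (y, x) = 1 - y\<close> leaves the divergent integral of \<open>1 / x\<close>.
\<close>

section \<open>Laws on the unit interval and their moments\<close>

text \<open>
  Polynomials are uniformly dense in the continuous functions on the unit interval, so equal moments
  give equal integrals of all continuous functions. Applied to cosines and sines, this identifies the
  characteristic functions.
\<close>

lemma real_distribution_eq_if_moments_eq:
  fixes M N :: "real measure"
  assumes M: "real_distribution M" "AE x in M. x \<in> {0..1}"
    and N: "real_distribution N" "AE x in N. x \<in> {0..1}"
    and moments: "\<And>m::nat. (\<integral>x. x ^ m \<partial>M) = (\<integral>x. x ^ m \<partial>N)"
  shows "M = N"
proof (rule Levy_uniqueness[OF M(1) N(1)])
  interpret M: real_distribution M by (rule M(1))
  interpret N: real_distribution N by (rule N(1))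
  have int: "integrable P g" if "P = M \<or> P = N" "continuous_on UNIV g" for P and g :: "real \<Rightarrow> real"
  proof -
    have g [measurable]: "g \<in> borel_measurable borel"
      using that(2) by (rule borel_measurable_continuous_onI)
    have "bounded (g ` {0..1})"
      using that(2) by (intro compact_imp_bounded compact_continuous_image)
        (auto intro: continuous_on_subset)
    then obtain B where B: "\<And>x. x \<in> {0..1} \<Longrightarrow> norm (g x) \<le> B"
      unfolding bounded_iff by blast
    from that(1) have "real_distribution P" and P: "AE x in P. x \<in> {0..1}" using M N by auto
    then interpret P: real_distribution P by simp
    show ?thesis
      by (rule P.integrable_const_bound[where B = B]) (use eventually_mono[OF P B] in auto)
  qed
  have poly: "(\<integral>x. p x \<partial>M) = (\<integral>x. p x \<partial>N)" if "real_polynomial_function p" for p :: "real \<Rightarrow> real"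
  proof -
    from that obtain a n where p: "p = (\<lambda>x. \<Sum>i\<le>n. a i * x ^ i)"
      unfolding real_polynomial_function_iff_sum by blast
    have "integrable P (\<lambda>x. a i * x ^ i)" if "P = M \<or> P = N" for P i
      using that by (rule int) (intro continuous_intros)
    then show ?thesis
      using moments by (simp add: p Bochner_Integration.integral_sum)
  qed
  have cont: "(\<integral>x. g x \<partial>M) = (\<integral>x. g x \<partial>N)" if g: "continuous_on UNIV g" for g :: "real \<Rightarrow> real"
  proof -
    have "\<bar>(\<integral>x. g x \<partial>M) - (\<integral>x. g x \<partial>N)\<bar> \<le> e" if "e > 0" for e
    proof -
      obtain p where p: "real_polynomial_function p"
        and approx: "\<And>x. x \<in> {0..1} \<Longrightarrow> \<bar>g x - p x\<bar> < e / 2"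
        using Stone_Weierstrass_real_polynomial_function[of "{0..1::real}" g "e / 2"] g \<open>e > 0\<close>
        by (auto intro: continuous_on_subset)
      have p_cont: "continuous_on UNIV p"
        using p by (simp add: continuous_on_polymonial_function real_polynomial_function_eq)
      have close: "\<bar>(\<integral>x. g x \<partial>P) - (\<integral>x. p x \<partial>P)\<bar> \<le> e / 2" if "P = M \<or> P = N" for P
      proof -
        from that have "real_distribution P" and P: "AE x in P. x \<in> {0..1}" using M N by auto
        then interpret P: real_distribution P by simp
        have ints: "integrable P g" "integrable P p" using that g p_cont int by blast+
        have "\<bar>(\<integral>x. g x \<partial>P) - (\<integral>x. p x \<partial>P)\<bar> = \<bar>\<integral>x. g x - p x \<partial>P\<bar>"
          using ints by simp
        also have "\<dots> \<le> (\<integral>x. \<bar>g x - p x\<bar> \<partial>P)" by (rule integral_abs_bound)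
        also have "\<dots> \<le> (\<integral>x. e / 2 \<partial>P)"
          using ints eventually_mono[OF P less_imp_le[OF approx]] by (intro integral_mono_AE) auto
        also have "\<dots> = e / 2" by (simp only: lebesgue_integral_const P.prob_space scaleR_one)
        finally show ?thesis .
      qed
      show ?thesis using close[OF disjI1[OF refl]] close[OF disjI2[OF refl]] poly[OF p] by linarith
    qed
    then have "\<bar>(\<integral>x. g x \<partial>M) - (\<integral>x. g x \<partial>N)\<bar> \<le> 0" by (rule field_le_epsilon) simp
    then show ?thesis by simp
  qed
  show "char M = char N"
  proof
    fix t
    have iexp: "Re (CLINT x|P. iexp (t * x)) = (\<integral>x. cos (t * x) \<partial>P)"
      "Im (CLINT x|P. iexp (t * x)) = (\<integral>x. sin (t * x) \<partial>P)" if "P = M \<or> P = N" for P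
    proof -
      have "complex_integrable P (\<lambda>x. iexp (t * x))"
        using that M.integrable_iexp N.integrable_iexp by auto
      from integral_Re[OF this] integral_Im[OF this]
      show "Re (CLINT x|P. iexp (t * x)) = (\<integral>x. cos (t * x) \<partial>P)"
        "Im (CLINT x|P. iexp (t * x)) = (\<integral>x. sin (t * x) \<partial>P)"
        by (simp_all add: Re_exp Im_exp)
    qed
    show "char M t = char N t"
      unfolding char_def
    proof (rule complex_eqI)
      show "Re (CLINT x|M. iexp (t * x)) = Re (CLINT x|N. iexp (t * x))"
        unfolding iexp(1)[OF disjI1[OF refl]] iexp(1)[OF disjI2[OF refl]]
        by (intro cont continuous_intros)
      show "Im (CLINT x|M. iexp (t * x)) = Im (CLINT x|N. iexp (t * x))"
        unfolding iexp(2)[OF disjI1[OF refl]] iexp(2)[OF disjI2[OF refl]]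
        by (intro cont continuous_intros)
    qed
  qed
qed

text \<open>
  The derivative of \<open>x ^ Suc m * (1 - x) ^ Suc b\<close> integrates to zero, and it is a combination of the
  integrands for \<open>m\<close> and \<open>Suc m\<close>. This gives a recursion in \<open>m\<close>.
\<close>

lemma nn_integral_beta_moment:
  "(\<integral>\<^sup>+x. ennreal (x ^ m * (1 - x) ^ b) * indicator {0..1} x \<partial>lborel) = ennreal (fact m / pochhammer (real b + 1) (Suc m))"
  (is "?L m = _")
proof -
  let ?I = "\<lambda>m. fact m / pochhammer (real b + 1) (Suc m)"
  have "((\<lambda>x. x ^ m * (1 - x) ^ b) has_integral ?I m) {0..1::real}"
  proof (induction m)
    case 0
    let ?F = "\<lambda>x::real. - ((1 - x) ^ Suc b / real (Suc b))"
    have "(?F has_real_derivative (1 - x) ^ b) (at x within {0..1})" for x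
      by (rule derivative_eq_intros refl | simp del: power_Suc of_nat_Suc)+
    then have "((\<lambda>x. (1 - x) ^ b) has_integral (?F 1 - ?F 0)) {0..1::real}"
      by (intro fundamental_theorem_of_calculus) (auto simp flip: has_real_derivative_iff_has_vector_derivative)
    then show ?case by (simp add: add.commute)
  next
    case (Suc m)
    \<comment> \<open>A primitive that vanishes at both endpoints.\<close>
    let ?F = "\<lambda>x::real. - (x ^ Suc m * (1 - x) ^ Suc b) / (real m + real b + 2)"
    let ?f = "\<lambda>x::real. x ^ Suc m * (1 - x) ^ b - (real m + 1) / (real m + real b + 2) * (x ^ m * (1 - x) ^ b)"
    have nz: "real m + real b + 2 \<noteq> 0" by linarith
    have "(?F has_real_derivative ?f x) (at x within {0..1})" for x
    proof -
      have "(?F has_real_derivative - ((real m + 1) * x ^ m * (1 - x) ^ Suc b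
          - (real b + 1) * x ^ Suc m * (1 - x) ^ b) / (real m + real b + 2)) (at x within {0..1})"
        by (rule derivative_eq_intros refl | simp add: nz)+ (simp add: algebra_simps add_divide_distrib diff_divide_distrib)
      also have "- ((real m + 1) * x ^ m * (1 - x) ^ Suc b
          - (real b + 1) * x ^ Suc m * (1 - x) ^ b) / (real m + real b + 2) = ?f x"
        using nz by (simp add: field_simps)
      finally show ?thesis .
    qed
    then have "(?f has_integral (?F 1 - ?F 0)) {0..1}"
      by (intro fundamental_theorem_of_calculus) (auto simp flip: has_real_derivative_iff_has_vector_derivative)
    from has_integral_add[OF this has_integral_mult_right[OF Suc, of "(real m + 1) / (real m + real b + 2)"]]
    have "((\<lambda>x. x ^ Suc m * (1 - x) ^ b) has_integral ((real m + 1) / (real m + real b + 2) * ?I m)) {0..1}"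
      by simp
    also have "(real m + 1) / (real m + real b + 2) * ?I m = ?I (Suc m)"
      by (subst (2) pochhammer_Suc) (simp add: add_ac)
    finally show ?case .
  qed
  then have "?L m = ennreal (?I m)"
    by (intro nn_integral_has_integral_lebesgue') (auto simp: pochhammer_pos)
  then show ?thesis by simp
qed

section \<open>One step of the urn\<close>

text \<open>
  The colours of the first \<open>n\<close> balls. It takes finitely many values, so every real function of it is
  integrable.
\<close>

definition red_upto :: "nat \<Rightarrow> nat \<Rightarrow> (nat \<Rightarrow> nat) \<Rightarrow> nat set" where
  "red_upto k n u = red_labels k u \<inter> {1..n}"

lemma red_upto_subset: "red_upto k n u \<subseteq> {1..n}"
  by (simp add: red_upto_def)

lemma finite_red_upto [simp]: "finite (red_upto k n u)"
  by (simp add: red_upto_def)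

lemma space_urn_picks_le: "u \<in> space (urn_picks k) \<Longrightarrow> k \<le> n \<Longrightarrow> u n \<in> {1..n}"
  by (auto simp: urn_picks_def space_PiM PiE_iff space_uniform_count_measure)

lemma red_upto_Suc:
  assumes "u \<in> space (urn_picks k)" "k \<le> n"
  shows "red_upto k (Suc n) u =
    (if u n \<in> red_upto k n u then insert (Suc n) (red_upto k n u) else red_upto k n u)"
proof -
  have "Suc n \<in> red_labels k u \<longleftrightarrow> u n \<in> red_upto k n u"
    using assms(2) space_urn_picks_le[OF assms]
    unfolding red_labels_iff[of "Suc n" k u] by (simp add: red_upto_def)
  moreover have "red_upto k (Suc n) u = {m. m = Suc n \<and> Suc n \<in> red_labels k u} \<union> red_upto k n u"
    by (auto simp: red_upto_def le_Suc_eq)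
  ultimately show ?thesis by auto
qed

lemma red_upto_initial:
  assumes "1 \<le> k"
  shows "red_upto k k u = {k}"
proof (intro set_eqI iffI)
  fix m assume "m \<in> red_upto k k u"
  then show "m \<in> {k}" using red_labels_ge[of m k u] by (simp add: red_upto_def)
next
  fix m assume "m \<in> {k}"
  then show "m \<in> red_upto k k u"
    using red_labels.initial[of k u] assms by (simp add: red_upto_def)
qed

text \<open>
  Only the picks before time \<open>n\<close> matter for these colours. This is what makes them independent of the
  pick at time \<open>n\<close>.
\<close>

lemma red_upto_restrict:
  assumes "u \<in> space (urn_picks k)"
  shows "red_upto k n (restrict u {k..<n}) = red_upto k n u"
proof -
  have "m \<le> n \<Longrightarrow> m \<in> red_labels k (restrict u {k..<n}) \<longleftrightarrow> m \<in> red_labels k u" for m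
  proof (induction m rule: less_induct)
    case (less m)
    have "restrict u {k..<n} i \<in> red_labels k (restrict u {k..<n}) \<longleftrightarrow> u i \<in> red_labels k u"
      if "m = Suc i" "k \<le> i" for i
    proof -
      from space_urn_picks_le[OF assms that(2)] have "u i < m" using that by auto
      then have "u i \<in> red_labels k (restrict u {k..<n}) \<longleftrightarrow> u i \<in> red_labels k u"
        using less.IH[OF \<open>u i < m\<close>] less.prems \<open>u i < m\<close> by linarith
      moreover have "restrict u {k..<n} i = u i" using less.prems that by simp
      ultimately show ?thesis by metis
    qed
    then show ?case
      unfolding red_labels_iff[of m k u] red_labels_iff[of m k "restrict u {k..<n}"] by blast
  qed
  then have "m \<in> red_upto k n (restrict u {k..<n}) \<longleftrightarrow> m \<in> red_upto k n u" for m
    by (cases "m \<le> n") (simp_all only: red_upto_def Int_iff atLeastAtMost_iff simp_thms)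
  then show ?thesis by (rule set_eqI)
qed

lemma measurable_red_upto:
  assumes "1 \<le> k"
  shows "red_upto k n \<in> measurable (urn_picks k) (count_space (Pow {1..n}))"
proof -
  have preimage: "red_upto k n -` {D} \<inter> space (urn_picks k) \<in> sets (urn_picks k)" if "D \<subseteq> {1..n}" for D
  proof -
    have "red_upto k n u = D \<longleftrightarrow> (\<forall>m\<in>{1..n}. m \<in> red_labels k u \<longleftrightarrow> m \<in> D)" for u
      using that unfolding red_upto_def by blast
    then have "red_upto k n -` {D} \<inter> space (urn_picks k) =
        {u \<in> space (urn_picks k). \<forall>m\<in>{1..n}. m \<in> red_labels k u \<longleftrightarrow> m \<in> D}"
      by auto
    also have "\<dots> \<in> sets (urn_picks k)"
    proof (intro sets.sets_Collect_finite_All finite_atLeastAtMost)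
      fix m
      show "{u \<in> space (urn_picks k). m \<in> red_labels k u \<longleftrightarrow> m \<in> D} \<in> sets (urn_picks k)"
        using sets_red_labels[OF assms, of m] sets.sets_Collect_neg[OF sets_red_labels[OF assms, of m]]
        by (cases "m \<in> D") simp_all
    qed
    finally show ?thesis .
  qed
  have "finite (Pow {1..n})" by simp
  from measurable_count_space_eq2[OF this, of "red_upto k n" "urn_picks k"] preimage red_upto_subset
  show ?thesis by auto
qed

lemma measurable_fun_red_upto:
  fixes g :: "nat set \<Rightarrow> real"
  assumes "1 \<le> k"
  shows "(\<lambda>u. g (red_upto k n u)) \<in> borel_measurable (urn_picks k)"
  by (rule measurable_compose[OF measurable_red_upto[OF assms]]) simp

lemma integrable_fun_red_upto:
  fixes g :: "nat set \<Rightarrow> real"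
  assumes "1 \<le> k"
  shows "integrable (urn_picks k) (\<lambda>u. g (red_upto k n u))"
proof -
  interpret prob_space "urn_picks k" by (rule prob_space_urn_picks[OF assms])
  have "finite (range (\<lambda>u. red_upto k n u))"
    by (rule finite_subset[of _ "Pow {1..n}"]) (auto simp: red_upto_def)
  then have "bounded (g ` range (red_upto k n))" by (rule finite_imp_bounded[OF finite_imageI])
  then obtain B where "norm (g (red_upto k n u)) \<le> B" for u
    unfolding bounded_iff by blast
  then show ?thesis
    by (intro integrable_const_bound[where B = B] measurable_fun_red_upto assms) auto
qed

lemma indep_vars_picks:
  assumes "1 \<le> k"
  shows "prob_space.indep_vars (urn_picks k) (\<lambda>n. uniform_count_measure {1..n}) (\<lambda>n u. u n) {k..}"
proof -
  interpret prob_space "urn_picks k" by (rule prob_space_urn_picks[OF assms])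
  let ?M = "\<lambda>n. uniform_count_measure {1..n::nat}"
  have "distr (urn_picks k) (Pi\<^sub>M {k..} ?M) (\<lambda>u. \<lambda>n\<in>{k..}. u n) = distr (urn_picks k) (urn_picks k) (\<lambda>u. u)"
    by (rule distr_cong) (auto simp: urn_picks_def space_PiM)
  also have "\<dots> = Pi\<^sub>M {k..} ?M" by (simp add: urn_picks_def)
  also have "\<dots> = Pi\<^sub>M {k..} (\<lambda>n. distr (urn_picks k) (?M n) (\<lambda>u. u n))"
    using assms unfolding urn_picks_def
    by (intro PiM_cong distr_PiM_component[symmetric] refl prob_space_uniform_count_measure) auto
  finally show ?thesis
    by (subst indep_vars_iff_distr_eq_PiM')
      (auto simp: urn_picks_def intro!: measurable_component_singleton)
qed

lemma integral_pick_eq: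
  assumes "1 \<le> k" "k \<le> n" "j \<in> {1..n}"
  shows "(\<integral>u. of_bool (u n = j) \<partial>urn_picks k) = 1 / real n"
proof -
  let ?U = "uniform_count_measure {1..n}"
  have distr: "distr (urn_picks k) ?U (\<lambda>u. u n) = ?U"
    using assms unfolding urn_picks_def
    by (intro distr_PiM_component prob_space_uniform_count_measure) auto
  have pick: "(\<lambda>u. u n) \<in> measurable (urn_picks k) ?U"
    using assms unfolding urn_picks_def by (intro measurable_component_singleton) auto
  have "(\<lambda>i. of_bool (i = j) :: real) \<in> borel_measurable ?U"
    by (auto simp: measurable_def sets_uniform_count_measure space_uniform_count_measure)
  from integral_distr[OF pick this]
  have "(\<integral>u. (of_bool (u n = j) :: real) \<partial>urn_picks k) = (\<integral>i. of_bool (i = j) \<partial>?U)"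
    unfolding distr by simp
  also have "\<dots> = 1 / real n"
  proof -
    have "(\<Sum>i\<in>{1..n}. of_bool (i = j) :: real) = (\<Sum>i\<in>{1..n}. if i = j then 1 else 0)"
      by (intro sum.cong) auto
    then show ?thesis using assms(3) by (simp add: integral_uniform_count_measure)
  qed
  finally show ?thesis .
qed

text \<open>
  The pick at time \<open>n\<close> is uniform and independent of the colours of the balls present.
\<close>

lemma integral_past_times_pick:
  fixes g :: "nat set \<Rightarrow> real"
  assumes "1 \<le> k" "k \<le> n" "j \<in> {1..n}"
  shows "(\<integral>u. g (red_upto k n u) * of_bool (u n = j) \<partial>urn_picks k) =
    (\<integral>u. g (red_upto k n u) \<partial>urn_picks k) / real n"
    and "integrable (urn_picks k) (\<lambda>u. g (red_upto k n u) * of_bool (u n = j))"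
proof -
  interpret prob_space "urn_picks k" by (rule prob_space_urn_picks[OF assms(1)])
  let ?M = "\<lambda>n. uniform_count_measure {1..n::nat}"
  let ?past = "\<lambda>u. restrict u {k..<n}" and ?pick = "\<lambda>u. restrict u {n}"
  let ?g = "\<lambda>v. g (red_upto k n v)" and ?h = "\<lambda>v. of_bool (v n = j) :: real"
  have sets_eq: "sets (Pi\<^sub>M {k..<n} ?M) = sets (Pi\<^sub>M {k..<n} (\<lambda>i. count_space {1..i}))"
    by (intro sets_PiM_cong) (auto simp: sets_uniform_count_measure)
  have "?g \<in> borel_measurable (Pi\<^sub>M {k..<n} ?M)"
    unfolding measurable_cong_sets[OF sets_eq refl] by (subst count_space_PiM_finite) auto
  moreover have "?h \<in> borel_measurable (Pi\<^sub>M {n} ?M)"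
    by (rule measurable_compose[OF measurable_component_singleton])
      (auto simp: measurable_def sets_uniform_count_measure space_uniform_count_measure)
  ultimately have "indep_var borel (?g \<circ> ?past) borel (?h \<circ> ?pick)"
    using assms(2)
    by (intro indep_var_compose[OF indep_var_restrict[OF indep_vars_picks[OF assms(1)]]]) auto
  then have indep: "indep_var borel (\<lambda>u. ?g (?past u)) borel ?h"
    by (simp add: comp_def)
  have eq: "?g (?past u) = ?g u" if "u \<in> space (urn_picks k)" for u
    using red_upto_restrict[OF that] by simp
  have int_g: "integrable (urn_picks k) (\<lambda>u. ?g (?past u))"
    using integrable_fun_red_upto[OF assms(1)] by (subst Bochner_Integration.integrable_cong[OF refl eq])
  have "(\<lambda>u. u n) \<in> measurable (urn_picks k) (?M n)"
    using assms unfolding urn_picks_def by (intro measurable_component_singleton) auto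
  then have "?h \<in> borel_measurable (urn_picks k)"
    by (rule measurable_compose) (auto simp: measurable_def sets_uniform_count_measure space_uniform_count_measure)
  then have int_h: "integrable (urn_picks k) ?h"
    by (intro integrable_const_bound[where B = 1]) auto
  have "(\<integral>u. ?g u * ?h u \<partial>urn_picks k) = (\<integral>u. ?g (?past u) * ?h u \<partial>urn_picks k)"
    by (rule Bochner_Integration.integral_cong) (simp_all only: eq)
  also have "\<dots> = (\<integral>u. ?g (?past u) \<partial>urn_picks k) * (\<integral>u. ?h u \<partial>urn_picks k)"
    by (rule indep_var_lebesgue_integral[OF indep int_g int_h])
  also have "(\<integral>u. ?g (?past u) \<partial>urn_picks k) = (\<integral>u. ?g u \<partial>urn_picks k)"
    by (rule Bochner_Integration.integral_cong) (simp_all only: eq)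
  finally show "(\<integral>u. ?g u * ?h u \<partial>urn_picks k) = (\<integral>u. ?g u \<partial>urn_picks k) / real n"
    by (simp add: integral_pick_eq[OF assms])
  have "integrable (urn_picks k) (\<lambda>u. ?g (?past u) * ?h u)"
    by (rule indep_var_integrable[OF indep int_g int_h])
  then show "integrable (urn_picks k) (\<lambda>u. ?g u * ?h u)"
    by (subst Bochner_Integration.integrable_cong[OF refl]) (simp_all only: eq)
qed

text \<open>
  Given the first \<open>n\<close> colours, ball \<open>n + 1\<close> is red with probability equal to the proportion of red
  balls. Summing over the possible labels of the picked ball reduces this to independence.
\<close>

lemma integral_red_upto_Suc:
  fixes F :: "nat set \<Rightarrow> real"
  assumes "1 \<le> k" "k \<le> n"
  shows "(\<integral>u. F (red_upto k (Suc n) u) \<partial>urn_picks k) =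
    (\<integral>u. F (red_upto k n u) + (F (insert (Suc n) (red_upto k n u)) - F (red_upto k n u))
        * (real (card (red_upto k n u)) / real n) \<partial>urn_picks k)"
proof -
  let ?d = "\<lambda>A. F (insert (Suc n) A) - F A"
  let ?h = "\<lambda>j A. ?d A * of_bool (j \<in> A)"
  have pick_sum: "of_bool (i \<in> A) = (\<Sum>j\<in>{1..n}. of_bool (j \<in> A) * of_bool (i = j) :: real)"
    if "i \<in> {1..n}" for i A
  proof -
    have "(\<Sum>j\<in>{1..n}. of_bool (j \<in> A) * of_bool (i = j) :: real) = (\<Sum>j\<in>{1..n}. if i = j then of_bool (i \<in> A) else 0)"
      by (intro sum.cong) auto
    then show ?thesis using that by simp
  qed
  have card_sum: "(\<Sum>j\<in>{1..n}. of_bool (j \<in> A)) = real (card A)" if "A \<subseteq> {1..n}" for A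
    using that by (simp add: of_bool_def sum.If_cases Int_absorb1)
  have "(\<integral>u. F (red_upto k (Suc n) u) \<partial>urn_picks k) =
      (\<integral>u. F (red_upto k n u) + (\<Sum>j\<in>{1..n}. ?h j (red_upto k n u) * of_bool (u n = j)) \<partial>urn_picks k)"
  proof (rule Bochner_Integration.integral_cong)
    fix u assume u: "u \<in> space (urn_picks k)"
    have "F (red_upto k (Suc n) u) = F (red_upto k n u) + ?d (red_upto k n u) * of_bool (u n \<in> red_upto k n u)"
      using red_upto_Suc[OF u assms(2)] by simp
    also have "\<dots> = F (red_upto k n u) + (\<Sum>j\<in>{1..n}. ?h j (red_upto k n u) * of_bool (u n = j))"
      unfolding pick_sum[OF space_urn_picks_le[OF u assms(2)]] by (simp only: sum_distrib_left mult.assoc)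
    finally show "F (red_upto k (Suc n) u) = \<dots>" .
  qed simp
  also have "\<dots> = (\<integral>u. F (red_upto k n u) \<partial>urn_picks k) +
      (\<Sum>j\<in>{1..n}. \<integral>u. ?h j (red_upto k n u) * of_bool (u n = j) \<partial>urn_picks k)"
    by (simp only: Bochner_Integration.integral_add Bochner_Integration.integral_sum Bochner_Integration.integrable_sum
      integrable_fun_red_upto[OF assms(1), of F n] integral_past_times_pick(2)[OF assms, where g = "?h _"])
  also have "(\<Sum>j\<in>{1..n}. \<integral>u. ?h j (red_upto k n u) * of_bool (u n = j) \<partial>urn_picks k) =
      (\<Sum>j\<in>{1..n}. \<integral>u. ?h j (red_upto k n u) / real n \<partial>urn_picks k)"
    using integral_past_times_pick(1)[OF assms, where g = "?h _"] by (intro sum.cong) auto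
  also have "\<dots> = (\<integral>u. (\<Sum>j\<in>{1..n}. ?h j (red_upto k n u) / real n) \<partial>urn_picks k)"
    by (intro Bochner_Integration.integral_sum[symmetric]
      integrable_fun_red_upto[OF assms(1), where g = "\<lambda>A. ?h _ A / real n"])
  also have "(\<lambda>u. (\<Sum>j\<in>{1..n}. ?h j (red_upto k n u) / real n)) =
      (\<lambda>u. ?d (red_upto k n u) * (real (card (red_upto k n u)) / real n))"
    by (simp only: sum_divide_distrib[symmetric] sum_distrib_left[symmetric] card_sum[OF red_upto_subset] times_divide_eq_right)
  also have "(\<integral>u. F (red_upto k n u) \<partial>urn_picks k) + (\<integral>u. ?d (red_upto k n u) * (real (card (red_upto k n u)) / real n) \<partial>urn_picks k) =
    (\<integral>u. F (red_upto k n u) + ?d (red_upto k n u) * (real (card (red_upto k n u)) / real n) \<partial>urn_picks k)"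
    by (intro Bochner_Integration.integral_add[symmetric] integrable_fun_red_upto[OF assms(1), where g = F]
      integrable_fun_red_upto[OF assms(1), where g = "\<lambda>A. ?d A * (real (card A) / real n)"])
  finally show ?thesis .
qed

section \<open>Moments of the proportion of red balls\<close>

text \<open>
  Rising factorials are eigenfunctions of the urn step: if \<open>x\<close> of \<open>n\<close> balls are red, the expected
  increase of \<open>pochhammer x m\<close> is \<open>pochhammer x m * m / n\<close>, because
  \<open>x * pochhammer (x + 1) m = pochhammer x m * (x + m)\<close>.
\<close>

lemma integral_pochhammer_red:
  assumes "1 \<le> k" "k \<le> n"
  shows "(\<integral>u. pochhammer (real (card (red_upto k n u))) m \<partial>urn_picks k) =
    fact m * pochhammer (real n) m / pochhammer (real k) m"
  using assms(2)
proof (induction n rule: dec_induct)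
  case base
  interpret prob_space "urn_picks k" by (rule prob_space_urn_picks[OF assms(1)])
  show ?case
    using assms(1) pochhammer_pos[of "real k" m] prob_space
    by (simp add: red_upto_initial[OF assms(1)] pochhammer_fact)
next
  case (step n)
  have n: "k \<le> n" "0 < real n" using step assms by auto
  let ?F = "\<lambda>A. pochhammer (real (card A)) m"
  have shift: "x * pochhammer (x + 1) m = pochhammer x m * (x + real m)" for x :: real
    by (metis pochhammer_Suc pochhammer_rec)
  have "?F (red_upto k n u) + (?F (insert (Suc n) (red_upto k n u)) - ?F (red_upto k n u)) * (real (card (red_upto k n u)) / real n)
      = ?F (red_upto k n u) * ((real n + real m) / real n)" for u
  proof -
    have "Suc n \<notin> red_upto k n u" by (simp add: red_upto_def)
    then show ?thesis
      using shift[of "real (card (red_upto k n u))"] n(2) by (simp add: field_simps)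
  qed
  then have "(\<integral>u. ?F (red_upto k (Suc n) u) \<partial>urn_picks k) =
      (\<integral>u. ?F (red_upto k n u) \<partial>urn_picks k) * ((real n + real m) / real n)"
    unfolding integral_red_upto_Suc[OF assms(1) n(1), of ?F] by simp
  also have "\<dots> = fact m * (pochhammer (real n) m * (real n + real m) / real n) / pochhammer (real k) m"
    unfolding step.IH by (simp add: mult_ac)
  also have "pochhammer (real n) m * (real n + real m) / real n = pochhammer (real (Suc n)) m"
    using shift[of "real n"] n(2) by (simp add: field_simps)
  finally show ?case .
qed

definition red_fraction :: "nat \<Rightarrow> nat \<Rightarrow> (nat \<Rightarrow> nat) \<Rightarrow> real" where
  "red_fraction k n u = prefix_frequency (red_labels k u) n"

lemma red_fraction_eq: "red_fraction k n u = real (card (red_upto k n u)) / real n"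
proof -
  have "{i \<in> {1..n}. i \<in> red_labels k u} = red_upto k n u" by (auto simp: red_upto_def)
  then show ?thesis by (simp add: red_fraction_def prefix_frequency_def)
qed

lemma red_fraction_bounds: "0 \<le> red_fraction k n u" "red_fraction k n u \<le> 1"
proof -
  have "card (red_upto k n u) \<le> card {1..n}" by (intro card_mono red_upto_subset) simp
  then show "0 \<le> red_fraction k n u" "red_fraction k n u \<le> 1"
    by (auto simp: red_fraction_eq divide_le_eq_1)
qed

text \<open>
  An earlier proportion is a function of the later set of red labels. The urn step can thus be applied
  to expressions that involve two times.
\<close>

lemma red_fraction_eq_card_Int:
  assumes "m \<le> n"
  shows "red_fraction k m u = real (card (red_upto k n u \<inter> {1..m})) / real m"
proof -
  have "red_upto k n u \<inter> {1..m} = red_upto k m u" using assms by (auto simp: red_upto_def)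
  then show ?thesis by (simp add: red_fraction_eq)
qed

lemma integrable_red_fraction:
  assumes "1 \<le> k" "m \<le> n"
  shows "integrable (urn_picks k) (\<lambda>u. h (red_fraction k m u) (red_fraction k n u) :: real)"
  unfolding red_fraction_eq_card_Int[OF assms(2)] red_fraction_eq[of k n]
  by (rule integrable_fun_red_upto[OF assms(1), where g = "\<lambda>A. h (real (card (A \<inter> {1..m})) / real m) (real (card A) / real n)"])

text \<open>
  The proportion of red balls is a martingale, tested here against its own value at time \<open>m\<close>.
\<close>

lemma integral_red_fraction_orthogonal:
  assumes "1 \<le> k" "k \<le> m" "m \<le> n"
  shows "(\<integral>u. red_fraction k m u * red_fraction k n u \<partial>urn_picks k) = (\<integral>u. (red_fraction k m u)\<^sup>2 \<partial>urn_picks k)"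
  using assms(3)
proof (induction n rule: dec_induct)
  case base
  show ?case by (simp add: power2_eq_square)
next
  case (step n)
  have n: "k \<le> n" "0 < real n" "m \<le> Suc n" using step assms by auto
  let ?m = "\<lambda>A. real (card (A \<inter> {1..m})) / real m"
  let ?F = "\<lambda>A. ?m A * (real (card A) / real (Suc n))"
  have "?F (red_upto k n u) + (?F (insert (Suc n) (red_upto k n u)) - ?F (red_upto k n u)) * (real (card (red_upto k n u)) / real n)
      = ?m (red_upto k n u) * (real (card (red_upto k n u)) / real n)" for u
  proof -
    have "Suc n \<notin> red_upto k n u" by (simp add: red_upto_def)
    moreover have "insert (Suc n) (red_upto k n u) \<inter> {1..m} = red_upto k n u \<inter> {1..m}"
      using step(1,2) by auto
    ultimately have "?F (insert (Suc n) (red_upto k n u)) = ?m (red_upto k n u) * ((real (card (red_upto k n u)) + 1) / real (Suc n))"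
      by (simp only: card_insert_disjoint[OF finite_red_upto]) (simp add: add.commute)
    moreover have "a * (c / (1 + x)) + (a * ((c + 1) / (1 + x)) - a * (c / (1 + x))) * (c / x) = a * (c / x)"
      if "x > 0" for a c x :: real
    proof -
      have "a * ((c + 1) / (1 + x)) - a * (c / (1 + x)) = a / (1 + x)"
        by (simp add: diff_divide_distrib[symmetric] algebra_simps)
      then have "a * (c / (1 + x)) + (a * ((c + 1) / (1 + x)) - a * (c / (1 + x))) * (c / x)
          = a * c * (1 / (1 + x) + 1 / (1 + x) / x)" by (simp add: distrib_left)
      also have "1 / (1 + x) + 1 / (1 + x) / x = 1 / x" using that by (simp add: divide_simps)
      finally show ?thesis by simp
    qed
    ultimately show ?thesis using n(2) by (simp only: of_nat_Suc)
  qed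
  then have "(\<integral>u. ?F (red_upto k (Suc n) u) \<partial>urn_picks k) =
      (\<integral>u. ?m (red_upto k n u) * (real (card (red_upto k n u)) / real n) \<partial>urn_picks k)"
    by (simp only: integral_red_upto_Suc[OF assms(1) n(1), of ?F])
  moreover have "(\<integral>u. red_fraction k m u * red_fraction k (Suc n) u \<partial>urn_picks k) =
      (\<integral>u. ?F (red_upto k (Suc n) u) \<partial>urn_picks k)"
    by (simp only: red_fraction_eq_card_Int[OF n(3)] red_fraction_eq[of k "Suc n"])
  moreover have "(\<integral>u. red_fraction k m u * red_fraction k n u \<partial>urn_picks k) =
      (\<integral>u. ?m (red_upto k n u) * (real (card (red_upto k n u)) / real n) \<partial>urn_picks k)"
    by (simp only: red_fraction_eq_card_Int[OF step(1)] red_fraction_eq[of k n])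
  ultimately show ?case using step.IH by argo
qed

text \<open>
  The square of the count is the difference of its rising factorials of order two and one.
\<close>

lemma integral_red_fraction_square:
  assumes "1 \<le> k" "k \<le> n"
  shows "(\<integral>u. (red_fraction k n u)\<^sup>2 \<partial>urn_picks k) =
    2 / (real k * (real k + 1)) - (1 / real k - 2 / (real k * (real k + 1))) / real n"
proof -
  let ?R = "\<lambda>u. real (card (red_upto k n u))"
  have n: "0 < real n" "0 < real k" using assms by auto
  have int: "integrable (urn_picks k) (\<lambda>u. pochhammer (?R u) m)" for m
    by (rule integrable_fun_red_upto[OF assms(1), where g = "\<lambda>A. pochhammer (real (card A)) m"])
  have "(red_fraction k n u)\<^sup>2 = (pochhammer (?R u) 2 - pochhammer (?R u) 1) / (real n)\<^sup>2" for u
    by (simp add: red_fraction_eq power2_eq_square numeral_2_eq_2 pochhammer_Suc algebra_simps)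
  then have "(\<integral>u. (red_fraction k n u)\<^sup>2 \<partial>urn_picks k) =
      ((\<integral>u. pochhammer (?R u) 2 \<partial>urn_picks k) - (\<integral>u. pochhammer (?R u) 1 \<partial>urn_picks k)) / (real n)\<^sup>2"
    using Bochner_Integration.integral_diff[OF int int, of 2 1] by (simp only: integral_divide_zero)
  also have "\<dots> = (2 * (real n * (real n + 1)) / (real k * (real k + 1)) - real n / real k) / (real n)\<^sup>2"
    unfolding integral_pochhammer_red[OF assms] by (simp add: numeral_2_eq_2 pochhammer_Suc)
  also have "\<dots> = 2 / (real k * (real k + 1)) - (1 / real k - 2 / (real k * (real k + 1))) / real n"
  proof -
    have "(a * (x * (x + 1)) - b * x) / x\<^sup>2 = a - (b - a) / x" if "0 < x" for a b x :: real
      using that by (simp add: field_simps power2_eq_square)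
    from this[OF n(1), of "2 / (real k * (real k + 1))" "1 / real k"] show ?thesis by simp
  qed
  finally show ?thesis .
qed

text \<open>
  By orthogonality the variance of an increment is the difference of the second moments.
\<close>

lemma integral_red_fraction_increment:
  assumes "1 \<le> k" "k \<le> m" "m \<le> n"
  shows "(\<integral>u. (red_fraction k n u - red_fraction k m u)\<^sup>2 \<partial>urn_picks k) \<le> 1 / real m - 1 / real n"
proof -
  note int = integrable_red_fraction[OF assms(1,3)]
  have "(\<integral>u. (red_fraction k n u - red_fraction k m u)\<^sup>2 \<partial>urn_picks k) =
    (\<integral>u. (red_fraction k n u)\<^sup>2 - 2 * (red_fraction k m u * red_fraction k n u) + (red_fraction k m u)\<^sup>2 \<partial>urn_picks k)"
    by (simp add: power2_eq_square algebra_simps)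
  also have "\<dots> = (\<integral>u. (red_fraction k n u)\<^sup>2 \<partial>urn_picks k)
      - 2 * (\<integral>u. red_fraction k m u * red_fraction k n u \<partial>urn_picks k) + (\<integral>u. (red_fraction k m u)\<^sup>2 \<partial>urn_picks k)"
    using int[of "\<lambda>x y. y\<^sup>2"] int[of "\<lambda>x y. x\<^sup>2"] int[of "\<lambda>x y. x * y"] by simp
  also have "\<dots> = (\<integral>u. (red_fraction k n u)\<^sup>2 \<partial>urn_picks k) - (\<integral>u. (red_fraction k m u)\<^sup>2 \<partial>urn_picks k)"
    unfolding integral_red_fraction_orthogonal[OF assms] by simp
  also have "\<dots> = (1 / real k - 2 / (real k * (real k + 1))) * (1 / real m - 1 / real n)"
    using assms integral_red_fraction_square[OF assms(1), of n] integral_red_fraction_square[OF assms(1,2)]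
    by (simp add: right_diff_distrib)
  also have "\<dots> \<le> 1 * (1 / real m - 1 / real n)"
  proof (rule mult_right_mono)
    show "1 / real k - 2 / (real k * (real k + 1)) \<le> 1"
    proof -
      have "1 / real k \<le> 1" "0 \<le> 2 / (real k * (real k + 1))" using assms(1) by auto
      then show ?thesis by linarith
    qed
    show "0 \<le> 1 / real m - 1 / real n" using assms by (simp add: frac_le)
  qed
  finally show ?thesis by simp
qed

section \<open>Almost sure convergence of the proportion\<close>

text \<open>
  A monotone count between \<open>N j\<close> and \<open>N (j + 1)\<close> lies between its values there, so its average is
  squeezed between the averages at the two ends up to the factor \<open>N (j + 1) / N j\<close>.
\<close>

lemma tendsto_average_of_subsequence:
  fixes c :: "nat \<Rightarrow> real" and N :: "nat \<Rightarrow> nat"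
  assumes mono: "mono c" and nonneg: "\<And>n. 0 \<le> c n"
    and N: "strict_mono N" "0 < N 0"
    and ratio: "(\<lambda>j. real (N (Suc j)) / real (N j)) \<longlonglongrightarrow> 1"
    and lim: "(\<lambda>j. c (N j) / real (N j)) \<longlonglongrightarrow> L"
  shows "(\<lambda>n. c n / real n) \<longlonglongrightarrow> L"
proof -
  \<comment> \<open>The index of the last subsequence time not after \<open>n\<close>.\<close>
  define J where "J n = Max {j. N j \<le> n}" for n
  have fin: "finite {j. N j \<le> n}" for n
    by (rule finite_subset[of _ "{..n}"]) (auto intro: order_trans[OF strict_mono_imp_increasing[OF N(1)]])
  have J_ge: "j \<le> J n" if "N j \<le> n" for j n
    unfolding J_def using that fin by (intro Max_ge) auto
  have J: "N (J n) \<le> n" "n < N (Suc (J n))" if "N 0 \<le> n" for n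
  proof -
    have "J n \<in> {j. N j \<le> n}" unfolding J_def using that fin by (intro Max_in) auto
    then show "N (J n) \<le> n" by simp
    show "n < N (Suc (J n))" using J_ge[of "Suc (J n)" n] by (meson not_less Suc_n_not_le_n)
  qed
  have J_top: "filterlim J at_top sequentially"
    unfolding filterlim_at_top eventually_sequentially using J_ge by blast
  have pos: "0 < real (N j)" for j
    using N strict_mono_less_eq[OF N(1), of 0 j] by auto
  have ratio': "(\<lambda>j. real (N j) / real (N (Suc j))) \<longlonglongrightarrow> 1"
    using tendsto_inverse[OF ratio] by simp
  let ?lo = "\<lambda>j. c (N j) / real (N j) * (real (N j) / real (N (Suc j)))"
  let ?hi = "\<lambda>j. c (N (Suc j)) / real (N (Suc j)) * (real (N (Suc j)) / real (N j))"
  have "?lo \<longlonglongrightarrow> L * 1" by (intro tendsto_mult lim ratio')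
  then have lo: "(\<lambda>n. ?lo (J n)) \<longlonglongrightarrow> L" using filterlim_compose[OF _ J_top] by simp
  have "?hi \<longlonglongrightarrow> L * 1" using LIMSEQ_Suc[OF lim] ratio by (intro tendsto_mult) simp_all
  then have hi: "(\<lambda>n. ?hi (J n)) \<longlonglongrightarrow> L" using filterlim_compose[OF _ J_top] by simp
  show ?thesis
  proof (rule tendsto_sandwich[OF _ _ lo hi])
    show "\<forall>\<^sub>F n in sequentially. ?lo (J n) \<le> c n / real n"
      using eventually_ge_at_top[of "N 0"]
    proof eventually_elim
      case (elim n)
      have "?lo (J n) = c (N (J n)) / real (N (Suc (J n)))" using pos[of "J n"] by simp
      also have "\<dots> \<le> c n / real n"
        using J[OF elim] pos[of "J n"] nonneg by (intro frac_le monoD[OF mono]) auto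
      finally show ?case .
    qed
    show "\<forall>\<^sub>F n in sequentially. c n / real n \<le> ?hi (J n)"
      using eventually_ge_at_top[of "N 0"]
    proof eventually_elim
      case (elim n)
      have "c n / real n \<le> c (N (Suc (J n))) / real (N (J n))"
        using J[OF elim] pos[of "J n"] nonneg by (intro frac_le monoD[OF mono]) auto
      also have "\<dots> = ?hi (J n)" using pos[of "Suc (J n)"] by simp
      finally show ?case .
    qed
  qed
qed

lemma AE_summable_if_summable_integrals:
  fixes f :: "nat \<Rightarrow> 'a \<Rightarrow> real"
  assumes int: "\<And>j. integrable M (f j)" and nonneg: "\<And>j x. 0 \<le> f j x"
    and sum: "summable (\<lambda>j. \<integral>x. f j x \<partial>M)"
  shows "AE x in M. summable (\<lambda>j. f j x)"
proof -
  have [measurable]: "f j \<in> borel_measurable M" for j using int by blast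
  have "(\<integral>\<^sup>+x. (\<Sum>j. ennreal (f j x)) \<partial>M) = (\<Sum>j. \<integral>\<^sup>+x. ennreal (f j x) \<partial>M)"
    by (rule nn_integral_suminf) measurable
  also have "\<dots> = (\<Sum>j. ennreal (\<integral>x. f j x \<partial>M))"
    using int nonneg by (simp add: nn_integral_eq_integral)
  also have "\<dots> \<noteq> \<infinity>"
    using sum nonneg by (simp add: ennreal_suminf_neq_top)
  finally have "AE x in M. (\<Sum>j. ennreal (f j x)) \<noteq> \<infinity>"
    by (intro nn_integral_noteq_infinite) auto
  then show ?thesis
    by eventually_elim (use nonneg in \<open>auto intro: summable_suminf_not_top\<close>)
qed

text \<open>
  The variance bound \<open>1 / m - 1 / n\<close> is too weak to sum over all times, but along the cubes it is of
  order \<open>1 / j ^ 4\<close>, so the increments have means of order \<open>1 / j\<^sup>2\<close>. Cubes are also dense enough that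
  the ratio of consecutive ones tends to one.
\<close>

lemma AE_convergent_red_fraction:
  assumes "1 \<le> k"
  shows "AE u in urn_picks k. convergent (\<lambda>n. red_fraction k n u)"
proof -
  interpret prob_space "urn_picks k" by (rule prob_space_urn_picks[OF assms])
  \<comment> \<open>Cubes, started at \<open>k\<close> so that every time considered has all initial balls present.\<close>
  define N where "N j = (j + k) ^ 3" for j
  have N_mono: "strict_mono N"
    unfolding N_def by (intro strict_monoI power_strict_mono) auto
  have N_ge: "k \<le> N j" for j
    using assms self_le_power[of "j + k" 3] by (simp add: N_def)
  define D where "D j u = \<bar>red_fraction k (N (Suc j)) u - red_fraction k (N j) u\<bar>" for j u
  have N_le: "N j \<le> N (Suc j)" for j using N_mono by (simp add: strict_mono_less_eq)
  have int_D: "integrable (urn_picks k) (D j)" for j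
    unfolding D_def
    by (rule integrable_red_fraction[OF assms N_le, where h = "\<lambda>x y. \<bar>y - x\<bar>"])
  have int_D2: "integrable (urn_picks k) (\<lambda>u. (D j u)\<^sup>2)" for j
    unfolding D_def
    by (rule integrable_red_fraction[OF assms N_le, where h = "\<lambda>x y. \<bar>y - x\<bar>\<^sup>2"])
  have D_le: "(\<integral>u. D j u \<partial>urn_picks k) \<le> 4 / (real (j + k))\<^sup>2" for j
  proof -
    define a where "a = real (j + k)"
    have a: "1 \<le> a" using assms by (simp add: a_def)
    have N: "real (N j) = a ^ 3" "real (N (Suc j)) = (a + 1) ^ 3"
      by (simp_all add: N_def a_def add_ac)
    have "(\<integral>u. (D j u)\<^sup>2 \<partial>urn_picks k) \<le> 1 / a ^ 3 - 1 / (a + 1) ^ 3"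
      using integral_red_fraction_increment[OF assms N_ge N_le, of j] by (simp add: D_def N)
    also have "\<dots> = (3 * a\<^sup>2 + 3 * a + 1) / (a ^ 3 * (a + 1) ^ 3)"
      using a by (simp add: divide_simps) (simp add: algebra_simps power2_eq_square power3_eq_cube)
    also have "\<dots> \<le> (7 * a\<^sup>2) / (a ^ 3 * a ^ 3)"
    proof (rule frac_le[OF _ _ _ mult_left_mono[OF power_mono]])
      have "a \<le> a\<^sup>2" "1 \<le> a\<^sup>2" using a by (simp_all add: power2_eq_square mult_ge1_I)
      then show "3 * a\<^sup>2 + 3 * a + 1 \<le> 7 * a\<^sup>2" by linarith
    qed (use a in auto)
    also have "\<dots> = 7 / a ^ 4" using a by (simp add: divide_simps power_numeral_reduce)
    finally have var: "(\<integral>u. (D j u)\<^sup>2 \<partial>urn_picks k) \<le> 7 / a ^ 4" .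
    \<comment> \<open>Arithmetic and geometric means, weighted so that both terms have mean of order \<open>1 / a\<^sup>2\<close>.\<close>
    have "D j u \<le> (a\<^sup>2 * (D j u)\<^sup>2 + 1 / a\<^sup>2) / 2" for u
    proof -
      have "0 \<le> (a * D j u - 1 / a)\<^sup>2" by simp
      also have "\<dots> = a\<^sup>2 * (D j u)\<^sup>2 + 1 / a\<^sup>2 - 2 * D j u"
        using a by (simp add: power2_diff power_mult_distrib power_divide)
      finally show ?thesis by simp
    qed
    then have "(\<integral>u. D j u \<partial>urn_picks k) \<le> (\<integral>u. (a\<^sup>2 * (D j u)\<^sup>2 + 1 / a\<^sup>2) / 2 \<partial>urn_picks k)"
      using int_D int_D2 by (intro integral_mono) auto
    also have "\<dots> = (a\<^sup>2 * (\<integral>u. (D j u)\<^sup>2 \<partial>urn_picks k) + 1 / a\<^sup>2) / 2"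
      using int_D2[of j] prob_space by simp
    also have "\<dots> \<le> (a\<^sup>2 * (7 / a ^ 4) + 1 / a\<^sup>2) / 2"
      using var by (intro divide_right_mono add_right_mono mult_left_mono) auto
    also have "\<dots> = 4 / a\<^sup>2" using a by (simp add: divide_simps power_numeral_reduce)
    finally show ?thesis by (simp add: a_def)
  qed
  have "summable (\<lambda>j. \<integral>u. D j u \<partial>urn_picks k)"
  proof (rule summable_comparison_test')
    have "summable (\<lambda>n. 1 / (real n)\<^sup>2)" using inverse_power_summable[of 2] by (simp add: field_simps)
    from summable_mult[OF summable_ignore_initial_segment[OF this, of k], of 4]
    show "summable (\<lambda>j. 4 / (real (j + k))\<^sup>2)" by simp
    show "norm (\<integral>u. D j u \<partial>urn_picks k) \<le> 4 / (real (j + k))\<^sup>2" if "0 \<le> j" for j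
      using D_le[of j] Bochner_Integration.integral_nonneg[of "urn_picks k" "D j"] by (simp add: D_def)
  qed
  then have "AE u in urn_picks k. summable (\<lambda>j. D j u)"
    by (rule AE_summable_if_summable_integrals[OF int_D, rotated]) (simp add: D_def)
  then show ?thesis
  proof eventually_elim
    case (elim u)
    define x where "x j = red_fraction k (N j) u" for j
    from elim have "summable (\<lambda>j. x (Suc j) - x j)"
      unfolding D_def x_def by (rule summable_rabs_cancel)
    then have "convergent (\<lambda>n. \<Sum>j<n. x (Suc j) - x j)" by (simp add: summable_iff_convergent)
    then have "convergent (\<lambda>n. x n - x 0)" by (simp add: sum_lessThan_telescope)
    then have "convergent (\<lambda>n. (x n - x 0) + x 0)" by (intro convergent_add convergent_const)
    then obtain L where L: "x \<longlonglongrightarrow> L" by (auto simp: convergent_def)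
    have "(\<lambda>n. real (card (red_upto k n u)) / real n) \<longlonglongrightarrow> L"
    proof (rule tendsto_average_of_subsequence[OF _ _ N_mono])
      show "mono (\<lambda>n. real (card (red_upto k n u)))"
        by (intro monoI of_nat_mono card_mono) (auto simp: red_upto_def)
      show "0 < N 0" using assms by (simp add: N_def)
      show "(\<lambda>j. real (card (red_upto k (N j) u)) / real (N j)) \<longlonglongrightarrow> L"
        using L unfolding x_def[abs_def] red_fraction_eq .
      have "(\<lambda>n. real (Suc n) / real n) \<longlonglongrightarrow> 1" by (rule LIMSEQ_Suc_n_over_n)
      then have "(\<lambda>j. (real (Suc (j + k)) / real (j + k)) ^ 3) \<longlonglongrightarrow> 1 ^ 3"
        by (intro tendsto_power) (rule LIMSEQ_ignore_initial_segment)
      then show "(\<lambda>j. real (N (Suc j)) / real (N j)) \<longlonglongrightarrow> 1"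
        by (simp add: N_def power_divide)
    qed simp
    then show ?case by (auto simp: convergent_def red_fraction_eq)
  qed
qed

section \<open>The law of the limiting proportion\<close>

definition limit_fraction :: "nat \<Rightarrow> (nat \<Rightarrow> nat) \<Rightarrow> real" where
  "limit_fraction k u = lim (\<lambda>n. red_fraction k n u)"

lemma measurable_red_fraction:
  "1 \<le> k \<Longrightarrow> (\<lambda>u. red_fraction k n u) \<in> borel_measurable (urn_picks k)"
  unfolding red_fraction_eq by (rule measurable_fun_red_upto)

lemma measurable_limit_fraction:
  "1 \<le> k \<Longrightarrow> limit_fraction k \<in> borel_measurable (urn_picks k)"
  unfolding limit_fraction_def[abs_def] by (intro borel_measurable_lim_metric measurable_red_fraction)

lemma AE_red_fraction_tendsto:
  assumes "1 \<le> k"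
  shows "AE u in urn_picks k. (\<lambda>n. red_fraction k n u) \<longlonglongrightarrow> limit_fraction k u"
  using AE_convergent_red_fraction[OF assms]
  by eventually_elim (simp add: limit_fraction_def convergent_LIMSEQ_iff)

lemma AE_limit_fraction_bounds:
  assumes "1 \<le> k"
  shows "AE u in urn_picks k. limit_fraction k u \<in> {0..1}"
  using AE_red_fraction_tendsto[OF assms]
proof eventually_elim
  case (elim u)
  then show ?case
    using LIMSEQ_le_const[OF elim, of 0] LIMSEQ_le_const2[OF elim, of 1] red_fraction_bounds by auto
qed

text \<open>
  The product of \<open>R n / n + i / n\<close> over \<open>i < m\<close> is a rising factorial divided by \<open>n ^ m\<close>. It has a
  known mean and tends to the \<open>m\<close>-th power of the limit, so dominated convergence applies.
\<close>

lemma integral_limit_fraction_power: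
  assumes "1 \<le> k"
  shows "(\<integral>u. limit_fraction k u ^ m \<partial>urn_picks k) = fact m / pochhammer (real k) m"
proof -
  interpret prob_space "urn_picks k" by (rule prob_space_urn_picks[OF assms])
  let ?p = "\<lambda>n u. \<Prod>i<m. (red_fraction k n u + real i / real n)"
  have shifted: "(\<lambda>n. \<Prod>i<m. (f n + real i / real n)) \<longlonglongrightarrow> x ^ m" if "f \<longlonglongrightarrow> x" for f and x :: real
  proof -
    have "(\<lambda>n. \<Prod>i<m. (f n + real i / real n)) \<longlonglongrightarrow> (\<Prod>i<m. (x + 0))"
      by (intro tendsto_prod tendsto_add that lim_const_over_n)
    then show ?thesis by simp
  qed
  have lim_int: "(\<lambda>n. \<integral>u. ?p n u \<partial>urn_picks k) \<longlonglongrightarrow> (\<integral>u. limit_fraction k u ^ m \<partial>urn_picks k)"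
  proof (rule integral_dominated_convergence[where w = "\<lambda>_. (1 + real m) ^ m"])
    show "AE u in urn_picks k. (\<lambda>n. ?p n u) \<longlonglongrightarrow> limit_fraction k u ^ m"
      using AE_red_fraction_tendsto[OF assms] by eventually_elim (rule shifted)
    show "AE u in urn_picks k. norm (?p n u) \<le> (1 + real m) ^ m" for n
    proof (rule AE_I2)
      fix u
      have "norm (?p n u) = (\<Prod>i<m. \<bar>red_fraction k n u + real i / real n\<bar>)"
        by (simp add: abs_prod)
      also have "\<dots> \<le> (\<Prod>i<m. 1 + real m)"
      proof (intro prod_mono conjI)
        fix i assume "i \<in> {..<m}"
        have "real i / real n \<le> real i" by (cases "n = 0") (simp_all add: divide_le_eq mult_le_cancel_left1)
        then have "real i / real n \<le> real m" using \<open>i \<in> {..<m}\<close> by simp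
        moreover have "0 \<le> real i / real n" by simp
        ultimately show "\<bar>red_fraction k n u + real i / real n\<bar> \<le> 1 + real m"
          using red_fraction_bounds[of k n u] by linarith
      qed simp
      finally show "norm (?p n u) \<le> (1 + real m) ^ m" by simp
    qed
    show "(\<lambda>u. limit_fraction k u ^ m) \<in> borel_measurable (urn_picks k)"
      using measurable_limit_fraction[OF assms] by measurable
    show "(\<lambda>u. ?p n u) \<in> borel_measurable (urn_picks k)" for n
      using measurable_red_fraction[OF assms] by measurable
  qed simp
  have lim_formula: "(\<lambda>n. fact m / pochhammer (real k) m * (\<Prod>i<m. (1 + real i / real n))) \<longlonglongrightarrow> fact m / pochhammer (real k) m * 1 ^ m"
    by (intro tendsto_mult tendsto_const shifted)
  have "\<forall>\<^sub>F n in sequentially. fact m / pochhammer (real k) m * (\<Prod>i<m. (1 + real i / real n)) = (\<integral>u. ?p n u \<partial>urn_picks k)"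
    using eventually_ge_at_top[of k]
  proof eventually_elim
    case (elim n)
    then have n: "real n > 0" using assms by simp
    have p: "(\<Prod>i<m. (x / real n + real i / real n)) = pochhammer x m / real n ^ m" for x
      by (simp add: pochhammer_prod lessThan_atLeast0 prod_dividef flip: add_divide_distrib)
    have "(\<integral>u. ?p n u \<partial>urn_picks k) = fact m * pochhammer (real n) m / pochhammer (real k) m / real n ^ m"
      unfolding red_fraction_eq p by (simp add: integral_pochhammer_red[OF assms elim])
    also have "\<dots> = fact m / pochhammer (real k) m * (\<Prod>i<m. (real n / real n + real i / real n))"
      unfolding p by simp
    finally show ?case using n by simp
  qed
  from LIMSEQ_unique[OF lim_int Lim_transform_eventually[OF lim_formula this]]
  show ?thesis by simp
qed

text \<open>
  The beta distribution with parameters \<open>1\<close> and \<open>k - 1\<close>.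
\<close>

definition beta_law :: "nat \<Rightarrow> real measure" where
  "beta_law k = density lborel (\<lambda>x. ennreal (real (k - 1) * (1 - x) ^ (k - 2)) * indicator {0..1} x)"

lemma beta_density_measurable:
  "(\<lambda>x. ennreal (real (k - 1) * (1 - x) ^ (k - 2)) * indicator {0..1} x) \<in> borel_measurable lborel"
  by measurable

lemma AE_beta_law_bounds: "AE x in beta_law k. x \<in> {0..1}"
  unfolding beta_law_def by (subst AE_density[OF beta_density_measurable]) (auto split: split_indicator)

lemma nn_integral_beta_law_power:
  assumes "2 \<le> k"
  shows "(\<integral>\<^sup>+x. ennreal (x ^ m) \<partial>beta_law k) = ennreal (fact m / pochhammer (real k) m)"
proof -
  obtain b where k: "k = b + 2" using assms le_Suc_ex by (metis add.commute)
  have density: "ennreal (real (k - 1) * (1 - x) ^ (k - 2)) * indicator {0..1} x * ennreal (x ^ m) =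
      ennreal (real b + 1) * (ennreal (x ^ m * (1 - x) ^ b) * indicator {0..1} x)" for x
  proof (cases "x \<in> {0..1}")
    case True
    have "ennreal ((real b + 1) * (1 - x) ^ b) * ennreal (x ^ m) = ennreal ((real b + 1) * (1 - x) ^ b * x ^ m)"
      using True by (intro ennreal_mult[symmetric]) auto
    also have "\<dots> = ennreal ((real b + 1) * (x ^ m * (1 - x) ^ b))" by (simp only: mult_ac)
    also have "\<dots> = ennreal (real b + 1) * ennreal (x ^ m * (1 - x) ^ b)"
      using True by (intro ennreal_mult) auto
    finally show ?thesis using True by (simp add: k add.commute)
  qed simp
  have "(\<integral>\<^sup>+x. ennreal (x ^ m) \<partial>beta_law k) =
      (\<integral>\<^sup>+x. ennreal (real b + 1) * (ennreal (x ^ m * (1 - x) ^ b) * indicator {0..1} x) \<partial>lborel)"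
    unfolding beta_law_def
    by (subst nn_integral_density[OF beta_density_measurable]) (simp_all only: density, measurable)
  also have "\<dots> = ennreal (real b + 1) * ennreal (fact m / pochhammer (real b + 1) (Suc m))"
    by (subst nn_integral_cmult) (auto simp: nn_integral_beta_moment)
  also have "\<dots> = ennreal (fact m / pochhammer (real k) m)"
  proof -
    have "ennreal (real b + 1) * ennreal (fact m / pochhammer (real b + 1) (Suc m)) =
        ennreal ((real b + 1) * (fact m / pochhammer (real b + 1) (Suc m)))"
      using pochhammer_pos[of "real b + 1" "Suc m"] by (intro ennreal_mult[symmetric]) auto
    also have "(real b + 1) * (fact m / pochhammer (real b + 1) (Suc m)) = fact m / pochhammer (real k) m"
      by (simp add: k pochhammer_rec add.commute)
    finally show ?thesis .
  qed
  finally show ?thesis .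
qed

lemma real_distribution_beta_law:
  assumes "2 \<le> k"
  shows "real_distribution (beta_law k)"
proof -
  have "emeasure (beta_law k) (space (beta_law k)) = 1"
    using nn_integral_beta_law_power[OF assms, of 0] by simp
  then interpret prob_space "beta_law k" by (rule prob_spaceI)
  show ?thesis by standard (simp_all add: beta_law_def)
qed

lemma distr_limit_fraction:
  assumes "2 \<le> k"
  shows "distr (urn_picks k) borel (limit_fraction k) = beta_law k"
proof (rule real_distribution_eq_if_moments_eq)
  have k: "1 \<le> k" using assms by simp
  interpret prob_space "urn_picks k" by (rule prob_space_urn_picks[OF k])
  note meas [measurable] = measurable_limit_fraction[OF k]
  show "real_distribution (distr (urn_picks k) borel (limit_fraction k))"
    using real_distribution_distr meas by simp
  show "AE x in distr (urn_picks k) borel (limit_fraction k). x \<in> {0..1}"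
    using AE_limit_fraction_bounds[OF k] by (subst AE_distr_iff) auto
  show "real_distribution (beta_law k)" by (rule real_distribution_beta_law[OF assms])
  show "AE x in beta_law k. x \<in> {0..1}" by (rule AE_beta_law_bounds)
  show "(\<integral>x. x ^ m \<partial>distr (urn_picks k) borel (limit_fraction k)) = (\<integral>x. x ^ m \<partial>beta_law k)" for m
  proof -
    have "(\<integral>x. x ^ m \<partial>beta_law k) = enn2real (\<integral>\<^sup>+x. ennreal (x ^ m) \<partial>beta_law k)"
      using AE_beta_law_bounds[of k] by (intro integral_eq_nn_integral) (auto simp: beta_law_def elim!: eventually_mono)
    also have "\<dots> = fact m / pochhammer (real k) m"
      using pochhammer_pos[of "real k" m] k by (simp add: nn_integral_beta_law_power[OF assms])
    also have "\<dots> = (\<integral>x. x ^ m \<partial>distr (urn_picks k) borel (limit_fraction k))"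
      by (subst integral_distr) (auto simp: integral_limit_fraction_power[OF k])
    finally show ?thesis by simp
  qed
qed

text \<open>
  The derivative of the geometric series at \<open>1 - x\<close>. The index is shifted by two so that the sum runs
  over the urns.
\<close>

lemma suminf_beta_densities:
  assumes "0 < x" "x \<le> 1"
  shows "(\<Sum>k. ennreal (real (k + 2 - 1) * (1 - x) ^ (k + 2 - 2))) = ennreal (1 / x\<^sup>2)"
proof -
  have "(\<lambda>k. of_nat (Suc k) * (1 - x) ^ k) sums (1 / (1 - (1 - x))\<^sup>2)"
    by (rule geometric_deriv_sums) (use assms in auto)
  then have "(\<lambda>k. real (k + 2 - 1) * (1 - x) ^ (k + 2 - 2)) sums (1 / x\<^sup>2)" by simp
  then show ?thesis
    by (rule suminf_ennreal_eq[rotated]) (use assms in simp)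
qed

section \<open>Binary partitions and their second block\<close>

text \<open>
  Whether \<open>i\<close> and \<open>j\<close> share a block is visible in the restriction to labels up to their maximum, and
  that restriction has finitely many possible values.
\<close>

lemma sets_joined:
  assumes "1 \<le> i" "1 \<le> j"
  shows "{\<pi> \<in> space partition_space. \<exists>B\<in>\<pi>. i \<in> B \<and> j \<in> B} \<in> sets partition_space"
proof -
  define n where "n = max i j"
  let ?G = "\<lambda>\<rho>. {\<pi>. partition_on {1..} \<pi> \<and> restrict_partition \<pi> n = \<rho>}"
  define R where "R = {\<rho> \<in> Pow (Pow {1..n}). \<exists>B\<in>\<rho>. i \<in> B \<and> j \<in> B}"
  have iff: "(\<exists>B\<in>\<pi>. i \<in> B \<and> j \<in> B) \<longleftrightarrow> restrict_partition \<pi> n \<in> R" for \<pi>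
  proof -
    have ij: "i \<in> {1..n}" "j \<in> {1..n}" using assms by (auto simp: n_def)
    have "\<exists>C\<in>restrict_partition \<pi> n. i \<in> C \<and> j \<in> C" if "B \<in> \<pi>" "i \<in> B" "j \<in> B" for B
      by (rule bexI[of _ "B \<inter> {1..n}"]) (use that ij in \<open>auto simp: restrict_partition_def\<close>)
    moreover have "\<exists>B\<in>\<pi>. i \<in> B \<and> j \<in> B" if "C \<in> restrict_partition \<pi> n" "i \<in> C" "j \<in> C" for C
      using that by (auto simp: restrict_partition_def)
    moreover have "restrict_partition \<pi> n \<in> Pow (Pow {1..n})" by (auto simp: restrict_partition_def)
    ultimately show ?thesis unfolding R_def mem_Collect_eq by metis
  qed
  have G: "?G \<rho> \<in> sets partition_space" for \<rho>
    unfolding partition_space_def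
  proof (rule in_measure_of)
    show "?G \<rho> \<in> {{\<pi>. partition_on {1..} \<pi> \<and> restrict_partition \<pi> n = \<rho>} |n \<rho>. True}"
      unfolding mem_Collect_eq by (rule exI[of _ n], rule exI[of _ \<rho>]) simp
  qed blast
  have "{\<pi> \<in> space partition_space. \<exists>B\<in>\<pi>. i \<in> B \<and> j \<in> B} = (\<Union>\<rho>\<in>R. ?G \<rho>)"
    by (auto simp: iff space_partition_space)
  also have "\<dots> \<in> sets partition_space"
    by (intro sets.finite_UN G) (simp add: R_def)
  finally show ?thesis .
qed

text \<open>
  The labels outside the block of \<open>1\<close>. Unlike \<open>nth_block\<close>, this is defined through pairs of labels
  sharing a block, which makes it measurable at once; on binary partitions it is the second block.
\<close>

definition other_labels :: "nat set set \<Rightarrow> nat set" where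
  "other_labels \<pi> = {m. 1 \<le> m \<and> \<not> (\<exists>B\<in>\<pi>. 1 \<in> B \<and> m \<in> B)}"

text \<open>
  Having exactly two blocks, phrased by countably many conditions on pairs of labels for the sake of
  measurability.
\<close>

definition is_binary :: "nat set set \<Rightarrow> bool" where
  "is_binary \<pi> \<longleftrightarrow> (\<exists>i. i \<in> other_labels \<pi>) \<and>
    (\<forall>i j. i \<in> other_labels \<pi> \<and> j \<in> other_labels \<pi> \<longrightarrow> (\<exists>B\<in>\<pi>. i \<in> B \<and> j \<in> B))"

lemma measurable_other_labels [measurable]:
  "Measurable.pred partition_space (\<lambda>\<pi>. m \<in> other_labels \<pi>)"
proof (cases "1 \<le> m")
  case True
  from sets.sets_Collect_neg[OF sets_joined[OF order_refl True]]
  have "Measurable.pred partition_space (\<lambda>\<pi>. \<not> (\<exists>B\<in>\<pi>. 1 \<in> B \<and> m \<in> B))"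
    unfolding pred_def .
  moreover have "m \<in> other_labels \<pi> \<longleftrightarrow> \<not> (\<exists>B\<in>\<pi>. 1 \<in> B \<and> m \<in> B)" for \<pi>
    using True unfolding other_labels_def by blast
  ultimately show ?thesis by presburger
next
  case False
  then have "m \<notin> other_labels \<pi>" for \<pi> by (simp add: other_labels_def)
  then show ?thesis by simp
qed

lemma measurable_is_binary [measurable]: "Measurable.pred partition_space is_binary"
proof -
  have "Measurable.pred partition_space
      (\<lambda>\<pi>. i \<in> other_labels \<pi> \<and> j \<in> other_labels \<pi> \<longrightarrow> (\<exists>B\<in>\<pi>. i \<in> B \<and> j \<in> B))" for i j
  proof (cases "1 \<le> i \<and> 1 \<le> j")
    case True
    then have [measurable]: "Measurable.pred partition_space (\<lambda>\<pi>. \<exists>B\<in>\<pi>. i \<in> B \<and> j \<in> B)"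
      using sets_joined by (simp add: pred_def)
    show ?thesis by measurable
  next
    case False
    then have "(i \<in> other_labels \<pi> \<and> j \<in> other_labels \<pi> \<longrightarrow> (\<exists>B\<in>\<pi>. i \<in> B \<and> j \<in> B)) = True" for \<pi>
      by (auto simp: other_labels_def)
    then show ?thesis by (simp only: measurable_const UNIV_I space_count_space)
  qed
  then show ?thesis
    using measurable_other_labels unfolding is_binary_def[abs_def] pred_def
    by (intro sets.sets_Collect_conj sets.sets_Collect_countable_Ex sets.sets_Collect_countable_All)
qed

lemma prefix_frequency_eq_sum:
  "prefix_frequency B n = (\<Sum>i\<in>{1..n}. of_bool (i \<in> B)) / real n"
proof -
  have "(\<Sum>i\<in>{1..n}. of_bool (i \<in> B) :: real) = (\<Sum>i\<in>{i \<in> {1..n}. i \<in> B}. 1)"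
    by (rule sum.mono_neutral_cong_right) auto
  then show ?thesis by (simp add: prefix_frequency_def)
qed

lemma measurable_prefix_frequency [measurable]:
  "(\<lambda>\<pi>. prefix_frequency (other_labels \<pi>) n) \<in> borel_measurable partition_space"
  unfolding prefix_frequency_eq_sum of_bool_def
  using measurable_other_labels unfolding pred_def
  by (intro borel_measurable_divide borel_measurable_sum measurable_If borel_measurable_const)

lemma measurable_asymptotic_frequency [measurable]:
  "(\<lambda>\<pi>. asymptotic_frequency (other_labels \<pi>)) \<in> borel_measurable partition_space"
  unfolding asymptotic_frequency_def by (intro borel_measurable_lim_metric) measurable

lemma measurable_has_asymptotic_frequency [measurable]:
  "Measurable.pred partition_space (\<lambda>\<pi>. has_asymptotic_frequency (other_labels \<pi>))"
proof -
  have "{\<pi> \<in> space partition_space. Cauchy (\<lambda>n. prefix_frequency (other_labels \<pi>) n)} \<in> sets partition_space"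
    by (rule sets_Collect_Cauchy) measurable
  then show ?thesis by (simp add: has_asymptotic_frequency_def Cauchy_convergent_iff pred_def)
qed

text \<open>
  The labels outside the block of \<open>1\<close> are pairwise in a common block, hence they form a single block.
\<close>

lemma is_binary_eq:
  assumes "partition_on {1..} \<pi>" "is_binary \<pi>"
  shows "\<pi> = {{1..} - other_labels \<pi>, other_labels \<pi>}"
proof -
  let ?R = "other_labels \<pi>"
  have uniq: "B = C" if "B \<in> \<pi>" "C \<in> \<pi>" "m \<in> B" "m \<in> C" for B C m
    using partition_onD2[OF assms(1)] that by (auto simp: disjoint_def)
  have ex: "\<exists>B\<in>\<pi>. m \<in> B" if "1 \<le> m" for m
    using partition_onD1[OF assms(1)] that by auto
  have sub: "B \<subseteq> {1..}" if "B \<in> \<pi>" for B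
    using partition_onD1[OF assms(1)] that by auto
  obtain B1 where B1: "B1 \<in> \<pi>" "1 \<in> B1" using ex[of 1] by auto
  have "(\<exists>B\<in>\<pi>. 1 \<in> B \<and> m \<in> B) \<longleftrightarrow> m \<in> B1" for m
    using B1 uniq[OF _ B1(1) _ B1(2)] by metis
  then have R: "?R = {1..} - B1"
    unfolding other_labels_def by (simp only: set_eq_iff mem_Collect_eq Diff_iff atLeast_iff simp_thms)
  obtain i where i: "i \<in> ?R" using assms(2) by (auto simp: is_binary_def)
  then obtain B2 where B2: "B2 \<in> \<pi>" "i \<in> B2" using ex[of i] by (auto simp: R)
  have "i \<notin> B1" using i unfolding R by simp
  then have disjoint: "m \<notin> B1" if "m \<in> B2" for m
    using uniq[OF B1(1) B2(1) _ that] B2(2) by metis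
  have "j \<in> B2" if "j \<in> ?R" for j
  proof -
    from assms(2) i that obtain B where "B \<in> \<pi>" "i \<in> B" "j \<in> B" by (auto simp: is_binary_def)
    with uniq[OF _ B2(1) _ B2(2)] show ?thesis by metis
  qed
  then have B2_eq: "B2 = ?R"
    using sub[OF B2(1)] disjoint unfolding R by (intro equalityI subsetI DiffI) auto
  have B1_eq: "B1 = {1..} - ?R" using sub[OF B1(1)] unfolding R by (simp add: double_diff)
  have "C = B1 \<or> C = B2" if "C \<in> \<pi>" for C
  proof -
    have "C \<noteq> {}" using that partition_onD3[OF assms(1)] by metis
    then obtain m where m: "m \<in> C" by (meson ex_in_conv)
    show ?thesis
    proof (cases "m \<in> B1")
      case True
      then show ?thesis using uniq[OF that B1(1) m] by simp
    next
      case False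
      then have "m \<in> B2" using sub[OF that] m unfolding B2_eq R by auto
      then show ?thesis using uniq[OF that B2(1) m] by simp
    qed
  qed
  then have "\<pi> = {B1, B2}" using B1(1) B2(1) by (intro equalityI subsetI) auto
  also have "\<dots> = {{1..} - ?R, ?R}"
    by (rule arg_cong2[where f = "\<lambda>A B. {A, B}", OF B1_eq B2_eq])
  finally show ?thesis .
qed

lemma nth_block_binary:
  assumes \<pi>: "\<pi> = {{1..} - R, R}" and R: "R \<subseteq> {1..}" "1 \<notin> R" "R \<noteq> {}"
  shows "nth_block \<pi> 1 = {1..} - R" "nth_block \<pi> 2 = R"
proof -
  define A where "A = {1..} - R"
  have A: "Inf A = 1"
    unfolding A_def by (rule cInf_eq_minimum) (use R in auto)
  have "Inf R \<in> R" using R(3) by (rule Inf_nat_def1)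
  then have "1 \<le> Inf R" "Inf R \<noteq> 1" using subsetD[OF R(1)] R(2) by (simp, metis)
  then have less: "1 < Inf R" by simp
  have below_A: "{C \<in> {A, R}. Inf C < Inf A} = {}" using less by (auto simp: A)
  have below_R: "{C \<in> {A, R}. Inf C < Inf R} = {A}" using less by (auto simp: A)
  define rank where "rank B = Suc (card {C \<in> {A, R}. Inf C < Inf B})" for B
  have rank: "rank A = 1" "rank R = 2"
    unfolding rank_def below_A below_R by simp_all
  have nth: "nth_block \<pi> i = \<Union>{B \<in> {A, R}. rank B = i}" for i
    unfolding nth_block_def \<pi> A_def[symmetric] rank_def ..
  have "{B \<in> {A, R}. rank B = 1} = {A}" "{B \<in> {A, R}. rank B = 2} = {R}"
    using rank by auto
  then show "nth_block \<pi> 1 = {1..} - R" "nth_block \<pi> 2 = R"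
    unfolding nth A_def[symmetric] by simp_all
qed

lemma prefix_frequency_complement:
  assumes "1 \<le> n"
  shows "prefix_frequency ({1..} - R) n = 1 - prefix_frequency R n"
proof -
  have "(\<Sum>i\<in>{1..n}. of_bool (i \<in> {1..} - R) :: real) = (\<Sum>i\<in>{1..n}. 1 - of_bool (i \<in> R))"
    by (intro sum.cong) auto
  then show ?thesis
    using assms by (simp add: prefix_frequency_eq_sum sum_subtractf diff_divide_distrib)
qed

lemma asymptotic_frequency_complement:
  assumes "has_asymptotic_frequency R"
  shows "has_asymptotic_frequency ({1..} - R)"
    and "asymptotic_frequency ({1..} - R) = 1 - asymptotic_frequency R"
proof -
  have "prefix_frequency R \<longlonglongrightarrow> asymptotic_frequency R"
    using assms by (simp add: has_asymptotic_frequency_def asymptotic_frequency_def convergent_LIMSEQ_iff)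
  then have "(\<lambda>n. 1 - prefix_frequency R n) \<longlonglongrightarrow> 1 - asymptotic_frequency R"
    by (intro tendsto_diff tendsto_const)
  moreover have "\<forall>\<^sub>F n in sequentially. 1 - prefix_frequency R n = prefix_frequency ({1..} - R) n"
    using eventually_ge_at_top[of 1] by eventually_elim (rule prefix_frequency_complement[symmetric])
  ultimately have "prefix_frequency ({1..} - R) \<longlonglongrightarrow> 1 - asymptotic_frequency R"
    by (rule Lim_transform_eventually)
  then show "has_asymptotic_frequency ({1..} - R)"
    "asymptotic_frequency ({1..} - R) = 1 - asymptotic_frequency R"
    by (auto simp: has_asymptotic_frequency_def asymptotic_frequency_def convergent_def limI)
qed

lemma other_labels_urn_partition:
  assumes "2 \<le> k"
  shows "other_labels (urn_partition k u) = red_labels k u"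
  using red_labels_ge[of _ k u] assms by (fastforce simp: other_labels_def urn_partition_def)

lemma is_binary_urn_partition:
  assumes "2 \<le> k"
  shows "is_binary (urn_partition k u)"
  unfolding is_binary_def other_labels_urn_partition[OF assms]
  using red_labels.initial[of k u] by (auto simp: urn_partition_def)

text \<open>
  A set is null for the sum of the laws if and only if it is null for each of them, and each law is an
  image of the picks.
\<close>

lemma AE_urn_sum_measureI:
  assumes P: "Measurable.pred partition_space P"
    and AE: "\<And>k. 2 \<le> k \<Longrightarrow> AE u in urn_picks k. P (urn_partition k u)"
  shows "AE \<pi> in urn_sum_measure. P \<pi>"
proof (rule AE_I)
  let ?N = "{\<pi> \<in> space partition_space. \<not> P \<pi>}"
  have N: "?N \<in> sets partition_space" using P by measurable
  have "emeasure (urn_law (k + 2)) ?N = 0" for k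
  proof -
    have "AE \<pi> in urn_law (k + 2). P \<pi>"
      unfolding urn_law_def
      using AE[of "k + 2"] P measurable_urn_partition[of "k + 2"] by (subst AE_distr_iff) (simp_all add: pred_def)
    then show ?thesis
      using N P by (subst (asm) AE_iff_measurable[OF _ refl])
        (auto simp: sets_urn_law sets_eq_imp_space_eq[OF sets_urn_law])
  qed
  then show "emeasure urn_sum_measure ?N = 0" using N by (simp add: emeasure_urn_sum_measure)
  show "?N \<in> sets urn_sum_measure" using N by (simp add: sets_urn_sum_measure)
  show "{\<pi> \<in> space urn_sum_measure. \<not> P \<pi>} \<subseteq> ?N" by (simp add: space_urn_sum_measure)
qed

section \<open>Frequencies under the sum of the urn laws\<close>

definition inverse_square_measure :: "real measure" where
  "inverse_square_measure = density lborel (\<lambda>x. ennreal (1 / x\<^sup>2) * indicator {0..1} x)"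

lemma asymptotic_frequency_urn_partition:
  "2 \<le> k \<Longrightarrow> asymptotic_frequency (other_labels (urn_partition k u)) = limit_fraction k u"
  by (simp add: other_labels_urn_partition asymptotic_frequency_def limit_fraction_def red_fraction_def)

text \<open>
  The image of a sum of measures is the sum of the images, here the beta laws; interchanging sum and
  integral leaves the sum of their densities.
\<close>

lemma distr_urn_sum_measure:
  "distr urn_sum_measure borel (\<lambda>\<pi>. asymptotic_frequency (other_labels \<pi>)) = inverse_square_measure"
  (is "distr _ _ ?Y = _")
proof (rule measure_eqI)
  show "sets (distr urn_sum_measure borel ?Y) = sets inverse_square_measure"
    by (simp add: inverse_square_measure_def)
  fix A assume "A \<in> sets (distr urn_sum_measure borel ?Y)"
  then have A [measurable]: "A \<in> sets borel" by simp
  let ?d = "\<lambda>k x. ennreal (real (k - 1) * (1 - x) ^ (k - 2)) * indicator {0..1} x"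
  have Y: "?Y \<in> borel_measurable urn_sum_measure"
    using measurable_asymptotic_frequency by (simp add: measurable_cong_sets[OF sets_urn_sum_measure refl])
  have law: "emeasure (urn_law k) (?Y -` A \<inter> space partition_space) = emeasure (beta_law k) A" if k: "2 \<le> k" for k
  proof -
    have "emeasure (urn_law k) (?Y -` A \<inter> space partition_space) =
        emeasure (distr (urn_law k) borel ?Y) A"
      using A measurable_asymptotic_frequency
      by (subst emeasure_distr) (auto simp: urn_law_def)
    also have "distr (urn_law k) borel ?Y = distr (urn_picks k) borel (\<lambda>u. ?Y (urn_partition k u))"
      unfolding urn_law_def
      by (subst distr_distr) (simp_all add: comp_def measurable_asymptotic_frequency measurable_urn_partition[OF k])
    also have "\<dots> = beta_law k"
      unfolding asymptotic_frequency_urn_partition[OF k] using distr_limit_fraction[OF k] by simp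
    finally show ?thesis .
  qed
  have "emeasure (distr urn_sum_measure borel ?Y) A = emeasure urn_sum_measure (?Y -` A \<inter> space partition_space)"
    using Y by (subst emeasure_distr) (auto simp: space_urn_sum_measure)
  also have "\<dots> = (\<Sum>k. emeasure (urn_law (k + 2)) (?Y -` A \<inter> space partition_space))"
    using measurable_sets[OF measurable_asymptotic_frequency A] by (rule emeasure_urn_sum_measure)
  also have "\<dots> = (\<Sum>k. emeasure (beta_law (k + 2)) A)"
    by (simp add: law)
  also have "\<dots> = (\<Sum>k. \<integral>\<^sup>+x. ?d (k + 2) x * indicator A x \<partial>lborel)"
    unfolding beta_law_def by (intro suminf_cong emeasure_density) measurable
  also have "\<dots> = (\<integral>\<^sup>+x. (\<Sum>k. ?d (k + 2) x * indicator A x) \<partial>lborel)"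
    by (intro nn_integral_suminf[symmetric]) measurable
  also have "\<dots> = (\<integral>\<^sup>+x. ennreal (1 / x\<^sup>2) * indicator {0..1} x * indicator A x \<partial>lborel)"
  proof (rule nn_integral_cong_AE)
    show "AE x in lborel. (\<Sum>k. ?d (k + 2) x * indicator A x) = ennreal (1 / x\<^sup>2) * indicator {0..1} x * indicator A x"
      \<comment> \<open>At \<open>0\<close> the sum diverges while \<open>1 / 0\<^sup>2 = 0\<close>.\<close>
      using AE_lborel_singleton[of 0]
    proof eventually_elim
      case (elim x)
      show ?case
      proof (cases "x \<in> A \<and> x \<in> {0..1}")
        case True
        then have "(\<Sum>k. ?d (k + 2) x * indicator A x) =
            (\<Sum>k. ennreal (real (k + 2 - 1) * (1 - x) ^ (k + 2 - 2)))"
          by (intro suminf_cong) (simp only: indicator_simps mult_1_right)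
        also have "\<dots> = ennreal (1 / x\<^sup>2)"
          using True elim by (intro suminf_beta_densities) auto
        finally show ?thesis using True by simp
      qed auto
    qed
  qed
  also have "\<dots> = emeasure inverse_square_measure A"
    unfolding inverse_square_measure_def by (subst emeasure_density) auto
  finally show "emeasure (distr urn_sum_measure borel ?Y) A = emeasure inverse_square_measure A" .
qed

text \<open>
  All facts about frequencies that the integral formula needs, transferred from the urns. The limit of
  prefix frequencies is meaningless where it does not exist, so they can hold only almost everywhere.
\<close>

lemma AE_urn_sum_measure_frequencies:
  "AE \<pi> in urn_sum_measure. has_asymptotic_frequency (nth_block \<pi> 1) \<and> has_asymptotic_frequency (nth_block \<pi> 2) \<and>
    asymptotic_frequency (nth_block \<pi> 1) = 1 - asymptotic_frequency (other_labels \<pi>) \<and>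
    asymptotic_frequency (nth_block \<pi> 2) = asymptotic_frequency (other_labels \<pi>) \<and>
    asymptotic_frequency (other_labels \<pi>) \<in> {0..1}"
proof -
  have "AE \<pi> in urn_sum_measure. is_binary \<pi> \<and> has_asymptotic_frequency (other_labels \<pi>) \<and>
      asymptotic_frequency (other_labels \<pi>) \<in> {0..1}"
  proof (rule AE_urn_sum_measureI)
    fix k :: nat assume k: "2 \<le> k"
    then have "1 \<le> k" by simp
    from AE_convergent_red_fraction[OF this] AE_limit_fraction_bounds[OF this]
    show "AE u in urn_picks k. is_binary (urn_partition k u) \<and> has_asymptotic_frequency (other_labels (urn_partition k u)) \<and>
      asymptotic_frequency (other_labels (urn_partition k u)) \<in> {0..1}"
    proof eventually_elim
      case (elim u)
      then show ?case
        unfolding asymptotic_frequency_urn_partition[OF k]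
        unfolding other_labels_urn_partition[OF k]
        by (simp add: is_binary_urn_partition[OF k] has_asymptotic_frequency_def red_fraction_def)
    qed
  qed measurable
  moreover have "AE \<pi> in urn_sum_measure. partition_on {1..} \<pi>"
    by (rule AE_I2) (simp add: space_urn_sum_measure space_partition_space)
  ultimately show ?thesis
  proof eventually_elim
    case (elim \<pi>)
    let ?R = "other_labels \<pi>"
    have "1 \<in> \<Union>\<pi>" unfolding partition_onD1[OF elim(2), symmetric] by simp
    then have "1 \<notin> ?R" unfolding other_labels_def by blast
    moreover have "?R \<subseteq> {1..}" unfolding other_labels_def by auto
    moreover have "?R \<noteq> {}" using elim(1) unfolding is_binary_def by blast
    ultimately have "nth_block \<pi> 1 = {1..} - ?R" "nth_block \<pi> 2 = ?R"
      using nth_block_binary[OF is_binary_eq[OF elim(2) conjunct1[OF elim(1)]]] by blast+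
    then show ?case using elim(1) asymptotic_frequency_complement[of ?R] by simp
  qed
qed

lemma nn_integral_frequencies:
  fixes f :: "real \<times> real \<Rightarrow> real"
  assumes f: "f \<in> borel_measurable (restrict_space borel ({0..1} \<times> {0..1}))"
    and nonneg: "\<forall>z \<in> {0..1} \<times> {0..1}. 0 \<le> f z"
  shows "(\<integral>\<^sup>+\<pi>. ennreal (f (asymptotic_frequency (nth_block \<pi> 1), asymptotic_frequency (nth_block \<pi> 2)))
            \<partial>urn_sum_measure) =
        (\<integral>\<^sup>+x\<in>{0..1}. ennreal (f (1 - x, x) / x\<^sup>2) \<partial>lborel)"
proof -
  \<comment> \<open>The function is measurable on the square only, so it is extended by zero.\<close>
  define h where "h z = indicator ({0..1} \<times> {0..1}) z * f z" for z
  have "{0..1} \<times> {0..1} \<in> sets (borel :: (real \<times> real) measure)"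
    by (intro borel_closed closed_Times closed_atLeastAtMost)
  then have [measurable]: "h \<in> borel_measurable borel"
    using f unfolding h_def[abs_def] by (simp add: borel_measurable_restrict_space_iff)
  have g [measurable]: "(\<lambda>x. h (1 - x, x)) \<in> borel_measurable borel"
    by measurable
  let ?Y = "\<lambda>\<pi>. asymptotic_frequency (other_labels \<pi>)"
  have Y [measurable]: "?Y \<in> borel_measurable urn_sum_measure"
    using measurable_asymptotic_frequency by (simp add: measurable_cong_sets[OF sets_urn_sum_measure refl])
  have "(\<integral>\<^sup>+\<pi>. ennreal (f (asymptotic_frequency (nth_block \<pi> 1), asymptotic_frequency (nth_block \<pi> 2)))
            \<partial>urn_sum_measure) = (\<integral>\<^sup>+\<pi>. ennreal (h (1 - ?Y \<pi>, ?Y \<pi>)) \<partial>urn_sum_measure)"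
  proof (rule nn_integral_cong_AE)
    show "AE \<pi> in urn_sum_measure.
        ennreal (f (asymptotic_frequency (nth_block \<pi> 1), asymptotic_frequency (nth_block \<pi> 2))) =
        ennreal (h (1 - ?Y \<pi>, ?Y \<pi>))"
      using AE_urn_sum_measure_frequencies
    proof eventually_elim
      case (elim \<pi>)
      then have "(1 - ?Y \<pi>, ?Y \<pi>) \<in> {0..1} \<times> {0..1}" by simp
      then have "h (1 - ?Y \<pi>, ?Y \<pi>) = f (1 - ?Y \<pi>, ?Y \<pi>)" unfolding h_def by simp
      then show ?case using elim by simp
    qed
  qed
  also have "\<dots> = (\<integral>\<^sup>+x. ennreal (h (1 - x, x)) \<partial>distr urn_sum_measure borel ?Y)"
    by (subst nn_integral_distr) auto
  also have "\<dots> = (\<integral>\<^sup>+x. ennreal (1 / x\<^sup>2) * indicator {0..1} x * ennreal (h (1 - x, x)) \<partial>lborel)"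
    unfolding distr_urn_sum_measure inverse_square_measure_def by (subst nn_integral_density) auto
  also have "\<dots> = (\<integral>\<^sup>+x\<in>{0..1}. ennreal (f (1 - x, x) / x\<^sup>2) \<partial>lborel)"
  proof (rule nn_integral_cong)
    fix x :: real
    show "ennreal (1 / x\<^sup>2) * indicator {0..1} x * ennreal (h (1 - x, x)) = ennreal (f (1 - x, x) / x\<^sup>2) * indicator {0..1} x"
    proof (cases "x \<in> {0..1}")
      case True
      then have "ennreal (1 / x\<^sup>2) * ennreal (f (1 - x, x)) = ennreal (1 / x\<^sup>2 * f (1 - x, x))"
        using nonneg by (intro ennreal_mult[symmetric]) auto
      then show ?thesis using True by (simp add: h_def)
    qed simp
  qed
  finally show ?thesis .
qed

text \<open>
  The part of the integral above \<open>exp (- n)\<close> already equals \<open>n\<close>.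
\<close>

lemma nn_integral_inverse_eq_infinity:
  "(\<integral>\<^sup>+x\<in>{0..1}. ennreal (x / x\<^sup>2) \<partial>lborel) = \<infinity>"
proof -
  have "of_nat n \<le> (\<integral>\<^sup>+x\<in>{0..1}. ennreal (x / x\<^sup>2) \<partial>lborel)" for n
  proof -
    have "(\<integral>\<^sup>+x. ennreal (1 / x) * indicator {exp (- real n)..1} x \<partial>lborel) = ennreal (ln 1 - ln (exp (- real n)))"
    proof (rule nn_integral_FTC_Icc[where F = ln and f = "\<lambda>x. 1 / x"])
      fix x assume "x \<in> {exp (- real n)..1}"
      then have "0 < x" using exp_gt_zero[of "- real n"] unfolding atLeastAtMost_iff by linarith
      then show "(ln has_real_derivative 1 / x) (at x)" "0 \<le> 1 / x"
        by (auto intro!: derivative_eq_intros)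
    qed auto
    then have "of_nat n = (\<integral>\<^sup>+x. ennreal (1 / x) * indicator {exp (- real n)..1} x \<partial>lborel)"
      by (simp add: ennreal_of_nat_eq_real_of_nat)
    also have "\<dots> \<le> (\<integral>\<^sup>+x\<in>{0..1}. ennreal (x / x\<^sup>2) \<partial>lborel)"
    proof (rule nn_integral_mono)
      fix x :: real
      show "ennreal (1 / x) * indicator {exp (- real n)..1} x \<le> ennreal (x / x\<^sup>2) * indicator {0..1} x"
      proof (cases "x \<in> {exp (- real n)..1}")
        case True
        then have "0 < x" "x \<le> 1" using exp_gt_zero[of "- real n"] unfolding atLeastAtMost_iff by linarith+
        then show ?thesis by (simp add: power2_eq_square split: split_indicator)
      qed simp
    qed
    finally show ?thesis .
  qed
  then have "(SUP n. of_nat n) \<le> (\<integral>\<^sup>+x\<in>{0..1}. ennreal (x / x\<^sup>2) \<partial>lborel)"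
    by (rule SUP_least)
  then show ?thesis by (simp add: ennreal_SUP_of_nat_eq_top top_unique)
qed

theorem proposition3:
  shows "(AE \<pi> in urn_sum_measure. has_asymptotic_frequency (nth_block \<pi> 1) \<and>
            has_asymptotic_frequency (nth_block \<pi> 2)) \<and>
    (\<forall>f :: real \<times> real \<Rightarrow> real.
        f \<in> borel_measurable (restrict_space borel ({0..1} \<times> {0..1})) \<longrightarrow>
        (\<forall>z \<in> {0..1} \<times> {0..1}. 0 \<le> f z) \<longrightarrow>
        (\<integral>\<^sup>+\<pi>. ennreal (f (asymptotic_frequency (nth_block \<pi> 1), asymptotic_frequency (nth_block \<pi> 2)))
            \<partial>urn_sum_measure) =
        (\<integral>\<^sup>+x\<in>{0..1}. ennreal (f (1 - x, x) / x\<^sup>2) \<partial>lborel)) \<and>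
    (\<integral>\<^sup>+\<pi>. ennreal (1 - asymptotic_frequency (nth_block \<pi> 1)) \<partial>urn_sum_measure) = \<infinity>"
proof (intro conjI allI impI)
  show "AE \<pi> in urn_sum_measure. has_asymptotic_frequency (nth_block \<pi> 1) \<and>
      has_asymptotic_frequency (nth_block \<pi> 2)"
    using AE_urn_sum_measure_frequencies by eventually_elim simp
  have "(\<lambda>z :: real \<times> real. 1 - fst z) \<in> borel_measurable (restrict_space borel ({0..1} \<times> {0..1}))"
    by (intro measurable_restrict_space1 borel_measurable_continuous_onI continuous_intros)
  from nn_integral_frequencies[OF this]
  show "(\<integral>\<^sup>+\<pi>. ennreal (1 - asymptotic_frequency (nth_block \<pi> 1)) \<partial>urn_sum_measure) = \<infinity>"
    using nn_integral_inverse_eq_infinity by simp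
qed (rule nn_integral_frequencies)

end
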